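(* Let $n,k,t$ be integers with $1\le t\le k\le n$. Then $\theta_f(K(n,k,\ge t))=\binom{n}{k}/f_{n,k,t}$.
   Context: $K(n,k,\ge t)$ is the graph whose vertices are the $k$-element subsets of $[n]=\{1,\dots,n\}$, two distinct subsets being adjacent iff they share at least $t$ elements. For an integer $r\ge 0$ with $t+2r\le n$, let $\mathcal{F}_{n,k,t,r}=\{A\subseteq[n]: |A|=k,\ |A\cap\{1,\dots,t+2r\}|\ge t+r\}$, and let $f_{n,k,t}=\max\{|\mathcal{F}_{n,k,t,r}| : r\ge 0 \text{ integer},\ t+2r\le n\}$. $\theta_f(G)$, the fractional clique covering number, is the fractional chromatic number $\chi_f(\overline{G})=\inf_b\chi_b(\overline{G})/b$ of the complement, where $\chi_b$ is the least number of colours in an assignment of $b$-element colour sets to vertices with adjacent vertices receiving disjoint sets. *)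

theory Defs
  imports Complex_Main
begin

record 'a sgraph =
  verts :: "'a set"
  adj :: "'a \<Rightarrow> 'a \<Rightarrow> bool"

definition complement_graph :: "'a sgraph \<Rightarrow> 'a sgraph" where
  "complement_graph G =
     \<lparr>verts = verts G,
      adj = (\<lambda>u v. u \<in> verts G \<and> v \<in> verts G \<and> u \<noteq> v \<and> \<not> adj G u v)\<rparr>"

definition is_fold_colouring :: "'a sgraph \<Rightarrow> nat \<Rightarrow> nat \<Rightarrow> ('a \<Rightarrow> nat set) \<Rightarrow> bool" where
  "is_fold_colouring G b m c \<longleftrightarrow>
     (\<forall>v \<in> verts G. c v \<subseteq> {..<m} \<and> card (c v) = b) \<and>
     (\<forall>u \<in> verts G. \<forall>v \<in> verts G. adj G u v \<longrightarrow> c u \<inter> c v = {})"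

text \<open>The least number of colours of a b-fold colouring; for a finite loopless graph
  some number of colours always suffices, so that \<open>LEAST\<close> is meaningful.\<close>

definition fold_chromatic_number :: "nat \<Rightarrow> 'a sgraph \<Rightarrow> nat" where
  "fold_chromatic_number b G = (LEAST m. \<exists>c. is_fold_colouring G b m c)"

definition fractional_chromatic_number :: "'a sgraph \<Rightarrow> real" where
  "fractional_chromatic_number G =
     (INF b \<in> {1::nat..}. real (fold_chromatic_number b G) / real b)"

definition fractional_clique_cover_number :: "'a sgraph \<Rightarrow> real" where
  "fractional_clique_cover_number G = fractional_chromatic_number (complement_graph G)"

definition K_ge :: "nat \<Rightarrow> nat \<Rightarrow> nat \<Rightarrow> nat set sgraph" where
  "K_ge n k t =
     \<lparr>verts = {A. A \<subseteq> {1..n} \<and> card A = k},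
      adj = (\<lambda>A B. A \<subseteq> {1..n} \<and> card A = k \<and> B \<subseteq> {1..n} \<and> card B = k \<and>
                   A \<noteq> B \<and> card (A \<inter> B) \<ge> t)\<rparr>"

definition frankl_family :: "nat \<Rightarrow> nat \<Rightarrow> nat \<Rightarrow> nat \<Rightarrow> nat set set" where
  "frankl_family n k t r =
     {A. A \<subseteq> {1..n} \<and> card A = k \<and> card (A \<inter> {1..t + 2 * r}) \<ge> t + r}"

definition frankl_max :: "nat \<Rightarrow> nat \<Rightarrow> nat \<Rightarrow> nat" where
  "frankl_max n k t = Max {card (frankl_family n k t r) | r. t + 2 * r \<le> n}"

end

theory Submission
  imports Defs "HOL-Combinatorics.Permutations"
begin

text \<open>
  A colour class of the complement of \<open>K(n,k,\<ge>t)\<close> is a \<open>t\<close>-intersecting family of \<open>k\<close>-sets, so the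
  lower bound follows by counting once such families are known to have at most \<open>f\<close> members; the upper
  bound takes the permutations of \<open>{1..n}\<close> as colours, \<open>\<pi>\<close> colouring the sets that it maps into a
  largest Frankl family.

  The bound by \<open>f\<close> is the complete intersection theorem of Ahlswede and Khachatrian, proved by their
  pushing-pulling method. Let \<open>F\<close> be a left-compressed maximum family that is symmetric on \<open>{1..l}\<close>
  but not on \<open>{1..l+1}\<close>. Pushing an element of \<open>{1..l}\<close> to \<open>l + 1\<close> in the asymmetric members of \<open>F\<close>
  produces clashes only between members with \<open>i\<close> and \<open>j\<close> elements in \<open>{1..l}\<close> where \<open>i + j = l + t\<close>.
  For \<open>i \<noteq> j\<close> one of two trades enlarges \<open>F\<close>. For \<open>i = j\<close> one keeps only the members containing a
  suitable further point \<open>m\<close>, in both the old and the pushed version; averaging over \<open>m\<close> shows that this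
  enlarges \<open>F\<close> as long as \<open>l < t + 2r\<close>, with \<open>r\<close> the optimal parameter. Complementing and reversing
  the ground set maps the problem to parameters \<open>n - k\<close> and \<open>n - 2k + t\<close> and gives symmetry on
  \<open>{t+2r+1..n}\<close> as well, and a family with both symmetries lies in the Frankl family. When two values
  of \<open>r\<close> are optimal, the averaging argument only preserves the size; then \<open>F\<close> is chosen to have as few
  elements beyond \<open>t + 2r\<close> as possible.
\<close>

section \<open>Exchanges in set families\<close>

definition k_sets :: "nat \<Rightarrow> nat \<Rightarrow> nat set set" where
  "k_sets n k = {A. A \<subseteq> {1..n} \<and> card A = k}"

definition intersecting :: "nat \<Rightarrow> nat \<Rightarrow> nat \<Rightarrow> nat set set \<Rightarrow> bool" where
  "intersecting n k t F \<longleftrightarrow> F \<subseteq> k_sets n k \<and> (\<forall>A\<in>F. \<forall>B\<in>F. t \<le> card (A \<inter> B))"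

definition optimal :: "nat \<Rightarrow> nat \<Rightarrow> nat \<Rightarrow> nat set set \<Rightarrow> bool" where
  "optimal n k t F \<longleftrightarrow>
     intersecting n k t F \<and> (\<forall>G. intersecting n k t G \<longrightarrow> card G \<le> card F)"

definition exchange_closed :: "nat set set \<Rightarrow> nat \<Rightarrow> nat \<Rightarrow> bool" where
  "exchange_closed F x y \<longleftrightarrow> (\<forall>A\<in>F. y \<in> A \<longrightarrow> x \<notin> A \<longrightarrow> insert x (A - {y}) \<in> F)"

definition left_compressed :: "nat \<Rightarrow> nat set set \<Rightarrow> bool" where
  "left_compressed n F \<longleftrightarrow> (\<forall>x y. 1 \<le> x \<longrightarrow> x < y \<longrightarrow> y \<le> n \<longrightarrow> exchange_closed F x y)"

definition symmetric_on :: "nat set \<Rightarrow> nat set set \<Rightarrow> bool" where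
  "symmetric_on S F \<longleftrightarrow> (\<forall>x\<in>S. \<forall>y\<in>S. exchange_closed F x y)"

lemma finite_k_sets [simp]: "finite (k_sets n k)"
  by (rule finite_subset[of _ "Pow {1..n}"]) (auto simp: k_sets_def)

lemma card_k_sets: "card (k_sets n k) = n choose k"
  using n_subsets[of "{1..n}" k] by (simp add: k_sets_def)

lemma k_setsD: "A \<in> k_sets n k \<Longrightarrow> A \<subseteq> {1..n} \<and> card A = k \<and> finite A"
  by (auto simp: k_sets_def intro: finite_subset)

lemma exchange_closedD:
  "\<lbrakk>exchange_closed F x y; A \<in> F; y \<in> A; x \<notin> A\<rbrakk> \<Longrightarrow> insert x (A - {y}) \<in> F"
  by (auto simp: exchange_closed_def)

lemma intersecting_finite: "intersecting n k t F \<Longrightarrow> finite F"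
  unfolding intersecting_def by (meson finite_k_sets finite_subset)

lemma card_exchange: "\<lbrakk>finite A; y \<in> A; x \<notin> A\<rbrakk> \<Longrightarrow> card (insert x (A - {y})) = card A"
  by (metis Diff_iff card.remove card_insert_disjoint finite_Diff)

text \<open>Each exchange trades an element of \<open>A - B\<close> for one of \<open>B - A\<close>,
  so \<open>A\<close> comes one step closer to \<open>B\<close>, and later exchanges only use pairs
  from the original differences.\<close>

lemma exchange_reach:
  assumes "A \<in> F" "finite A" "finite B" "card A = card B"
    and "\<And>x y. x \<in> B - A \<Longrightarrow> y \<in> A - B \<Longrightarrow> exchange_closed F x y"
  shows "B \<in> F"
  using assms
proof (induction "card (B - A)" arbitrary: A)
  case 0
  then have "B \<subseteq> A" by simp
  then show ?case using 0 by (metis card_subset_eq)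
next
  case (Suc m)
  then obtain x where x: "x \<in> B - A" by (metis card.empty equals0I nat.distinct(1))
  have "A - B \<noteq> {}"
    using x Suc.prems by (metis Diff_eq_empty_iff Diff_iff card_subset_eq)
  then obtain y where y: "y \<in> A - B" by blast
  let ?A = "insert x (A - {y})"
  have eq: "B - ?A = (B - A) - {x}" using x y by auto
  show ?case
  proof (rule Suc.hyps(1)[of ?A])
    show "m = card (B - ?A)" unfolding eq using x Suc.hyps(2) Suc.prems by simp
    show "?A \<in> F" using Suc.prems(5)[OF x y] Suc.prems(1) x y by (auto simp: exchange_closed_def)
    show "card ?A = card B" using card_exchange[of A y x] x y Suc.prems by auto
    show "exchange_closed F x' y'" if "x' \<in> B - ?A" "y' \<in> ?A - B" for x' y'
      using Suc.prems(5)[of x' y'] that x y by auto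
  qed (use Suc.prems in auto)
qed

lemma symmetric_on_mem:
  assumes "symmetric_on S F" "A \<in> F" "finite A" "finite B"
    and "A - S = B - S" "card (A \<inter> S) = card (B \<inter> S)"
  shows "B \<in> F"
proof (rule exchange_reach[OF assms(2-4)])
  have "card A = card (A \<inter> S) + card (A - S)" "card B = card (B \<inter> S) + card (B - S)"
    using assms(3,4) card_Int_Diff by blast+
  then show "card A = card B" using assms(5,6) by simp
  show "exchange_closed F x y" if "x \<in> B - A" "y \<in> A - B" for x y
    using assms(1,5) that unfolding symmetric_on_def by blast
qed

lemma threshold_mem:
  assumes "A \<in> F" "finite A" "finite B" "card A = card B"
    and "card (A \<inter> S) \<le> card (B \<inter> S)" "A \<union> B \<subseteq> N"
    and ex: "\<And>x y. x \<in> N \<Longrightarrow> y \<in> N \<Longrightarrow> x \<in> S \<or> y \<notin> S \<Longrightarrow> exchange_closed F x y"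
  shows "B \<in> F"
  using assms(1-6)
proof (induction "card (B - A)" arbitrary: A)
  case 0
  then have "B \<subseteq> A" by simp
  then show ?case using 0 by (metis card_subset_eq)
next
  case (Suc m)
  have ne: "B - A \<noteq> {}" using Suc.hyps(2) by (metis card.empty nat.distinct(1))
  then have ne': "A - B \<noteq> {}"
    using Suc.prems by (metis Diff_eq_empty_iff card_subset_eq)
  obtain x y where x: "x \<in> B - A" and y: "y \<in> A - B" and xy: "x \<in> S \<or> y \<notin> S"
    and le: "card (insert x (A - {y}) \<inter> S) \<le> card (B \<inter> S)"
  proof (cases "(B - A) \<inter> S = {}")
    case True
    then have "B \<inter> S \<subseteq> A \<inter> S" by blast
    then have "B \<inter> S = A \<inter> S" using Suc.prems by (intro card_subset_eq) (auto intro!: antisym card_mono)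
    then have *: "\<And>y. y \<in> A - B \<Longrightarrow> y \<notin> S" "\<And>y. y \<in> B - A \<Longrightarrow> y \<notin> S" by blast+
    obtain x y where "x \<in> B - A" "y \<in> A - B" using ne ne' by blast
    moreover have "insert x (A - {y}) \<inter> S = A \<inter> S" using * calculation by auto
    ultimately show thesis using that[of x y] * Suc.prems by metis
  next
    case False
    then obtain x where x: "x \<in> B - A" "x \<in> S" by blast
    show thesis
    proof (cases "(A - B) \<inter> S = {}")
      case True
      obtain y where y: "y \<in> A - B" using ne' by blast
      have "insert x (A - {y}) \<inter> S \<subseteq> B \<inter> S" using True x by blast
      then show thesis using that[of x y] x y Suc.prems by (meson card_mono finite_Int)
    next
      case False
      then obtain y where y: "y \<in> A - B" "y \<in> S" by blast
      have "insert x (A - {y}) \<inter> S = insert x (A \<inter> S - {y})" using x by blast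
      then have "card (insert x (A - {y}) \<inter> S) = card (A \<inter> S)"
        using card_exchange[of "A \<inter> S" y x] x y Suc.prems by auto
      then show thesis using that[of x y] x y Suc.prems by metis
    qed
  qed
  let ?A = "insert x (A - {y})"
  have eq: "B - ?A = (B - A) - {x}" using x y by auto
  show ?case
  proof (rule Suc.hyps(1)[of ?A])
    show "m = card (B - ?A)" unfolding eq using x Suc.hyps(2) Suc.prems by simp
    have "exchange_closed F x y" using ex[of x y] xy x y Suc.prems by blast
    then show "?A \<in> F" using Suc.prems(1) x y by (auto simp: exchange_closed_def)
    show "card ?A = card B" using card_exchange[of A y x] x y Suc.prems by auto
  qed (use Suc.prems x y le in auto)
qed

text \<open>\<open>Y\<close> uses up \<open>W - X\<close> before it touches \<open>X\<close>;
  truncated subtraction covers the case in which it never does. By \<open>card_inter_ge\<close> this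
  is the exact minimum, so \<open>Y\<close> is a worst-case partner for \<open>X\<close>.\<close>

lemma ex_min_intersection:
  assumes "finite W" "X \<subseteq> W" "b \<le> card W"
  shows "\<exists>Y\<subseteq>W. card Y = b \<and> card (X \<inter> Y) = card X + b - card W"
proof (cases "b \<le> card (W - X)")
  case True
  then obtain Y where Y: "Y \<subseteq> W - X" "card Y = b" by (meson obtain_subset_with_card_n)
  have "X \<inter> Y = {}" using Y by blast
  moreover have "card X + b \<le> card W"
    using True assms by (simp add: card_Diff_subset finite_subset card_mono le_diff_conv2 add.commute)
  ultimately show ?thesis using Y by (intro exI[of _ Y]) auto
next
  case False
  have fX: "finite X" using assms finite_subset by blast
  have c: "card (W - X) = card W - card X" "card X \<le> card W"
    using assms fX by (simp_all add: card_Diff_subset card_mono)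
  then have "b - card (W - X) \<le> card X" using assms by linarith
  then obtain Z where Z: "Z \<subseteq> X" "card Z = b - card (W - X)" by (meson obtain_subset_with_card_n)
  have "card (Z \<union> (W - X)) = card Z + card (W - X)"
    using Z assms fX by (intro card_Un_disjoint) (auto intro: finite_subset)
  moreover have "X \<inter> (Z \<union> (W - X)) = Z" using Z by blast
  ultimately show ?thesis using Z assms c False by (intro exI[of _ "Z \<union> (W - X)"]) auto
qed

lemma card_inter_ge:
  assumes "finite W" "X \<subseteq> W" "Y \<subseteq> W"
  shows "card X + card Y - card W \<le> card (X \<inter> Y)"
proof -
  have "card X + card Y = card (X \<union> Y) + card (X \<inter> Y)"
    using assms by (intro card_Un_Int) (auto intro: finite_subset)
  moreover have "card (X \<union> Y) \<le> card W" using assms by (intro card_mono) auto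
  ultimately show ?thesis by linarith
qed

section \<open>Pushing and pulling\<close>

text \<open>Setting of one induction step, in which symmetry on {1..l} is to be extended to
  {1..l+1}.\<close>

locale symmetric_prefix =
  fixes n k t l :: nat and F :: "nat set set"
  assumes opt: "optimal n k t F"
    and left: "left_compressed n F"
    and sym: "symmetric_on {1..l} F"
    and l_less: "l < n"
    and t_pos: "1 \<le> t"
begin

text \<open>\<open>tails i\<close> records the members of \<open>F\<close> with \<open>i\<close> elements in \<open>{1..l}\<close> that witness the
  asymmetry between \<open>l + 1\<close> and \<open>{1..l}\<close>: by symmetry on \<open>{1..l}\<close> only the part beyond
  \<open>l + 1\<close> matters.\<close>

definition tails :: "nat \<Rightarrow> nat set set" where
  "tails i = {T. T \<subseteq> {l+2..n} \<and> 1 \<le> i \<and> i \<le> l \<and>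
     (\<forall>X. X \<subseteq> {1..l} \<and> card X = i \<longrightarrow> X \<union> T \<in> F) \<and>
     (\<forall>Y. Y \<subseteq> {1..l} \<and> card Y = i - 1 \<longrightarrow> insert (l+1) (Y \<union> T) \<notin> F)}"

definition block :: "nat \<Rightarrow> nat set set \<Rightarrow> nat set set" where
  "block i U = (\<lambda>(X, T). X \<union> T) ` ({X. X \<subseteq> {1..l} \<and> card X = i} \<times> U)"

text \<open>One prefix element has been traded for \<open>l + 1\<close>; hence the level
  \<open>i - 1\<close>, which keeps the cardinality \<open>k\<close> for tails of level
  \<open>i\<close>.\<close>

definition pushed_block :: "nat \<Rightarrow> nat set set \<Rightarrow> nat set set" where
  "pushed_block i U = (\<lambda>(X, T). insert (l+1) (X \<union> T)) ` ({X. X \<subseteq> {1..l} \<and> card X = i - 1} \<times> U)"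

lemma F_mem: "A \<in> F \<Longrightarrow> A \<subseteq> {1..n} \<and> card A = k \<and> finite A"
  using opt k_setsD[of A n k] unfolding optimal_def intersecting_def by blast

lemma F_int: "A \<in> F \<Longrightarrow> B \<in> F \<Longrightarrow> t \<le> card (A \<inter> B)"
  using opt unfolding optimal_def intersecting_def by blast

lemma finite_F: "finite F"
  using opt intersecting_finite[of n k t F] unfolding optimal_def by blast

lemma tailsD:
  assumes "T \<in> tails i"
  shows "T \<subseteq> {l+2..n}" "1 \<le> i" "i \<le> l" "finite T"
    "\<And>X. X \<subseteq> {1..l} \<Longrightarrow> card X = i \<Longrightarrow> X \<union> T \<in> F"
    "\<And>Y. Y \<subseteq> {1..l} \<Longrightarrow> card Y = i - 1 \<Longrightarrow> insert (l+1) (Y \<union> T) \<notin> F"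
proof -
  show sub: "T \<subseteq> {l+2..n}" and "1 \<le> i" and "i \<le> l" using assms by (simp_all add: tails_def)
  show "finite T" using sub finite_subset by blast
  show "X \<union> T \<in> F" if "X \<subseteq> {1..l}" "card X = i" for X
    using assms that by (simp add: tails_def)
  show "insert (l+1) (Y \<union> T) \<notin> F" if "Y \<subseteq> {1..l}" "card Y = i - 1" for Y
    using assms that by (simp add: tails_def)
qed

lemma finite_tails: "finite (tails i)"
  by (rule finite_subset[of _ "Pow {l+2..n}"]) (auto simp: tails_def)

lemma card_tail:
  assumes "T \<in> tails i" shows "card T + i = k"
proof -
  obtain X where X: "X \<subseteq> {1..l}" "card X = i"
    using tailsD(3)[OF assms] obtain_subset_with_card_n[of i "{1..l}"] by auto
  have "X \<inter> T = {}" "finite X" using X(1) tailsD(1)[OF assms] finite_subset[OF X(1)] by fastforce+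
  then have "card (X \<union> T) = card X + card T"
    using tailsD(4)[OF assms] by (intro card_Un_disjoint)
  then show ?thesis using F_mem[OF tailsD(5)[OF assms X]] X by simp
qed

lemma prefix_symmetry:
  assumes "X \<subseteq> {1..l}" "Y \<subseteq> {1..l}" "card X = card Y" "S \<inter> {1..l} = {}" "X \<union> S \<in> F"
  shows "Y \<union> S \<in> F"
proof (rule symmetric_on_mem[OF sym assms(5)])
  have "(X \<union> S) \<inter> {1..l} = X" "(Y \<union> S) \<inter> {1..l} = Y" using assms by blast+
  then show "card ((X \<union> S) \<inter> {1..l}) = card ((Y \<union> S) \<inter> {1..l})" using assms by simp
  show "X \<union> S - {1..l} = Y \<union> S - {1..l}" using assms by blast
  show "finite (X \<union> S)" using F_mem assms(5) by blast
  then show "finite (Y \<union> S)" using assms(2) finite_subset by auto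
qed

text \<open>One failed exchange suffices: by symmetry a prefix can be replaced by any other of the
  same size, so a single pushed set of this tail in \<open>F\<close> would bring the failed one into
  \<open>F\<close> as well.\<close>

lemma tailsI:
  assumes "A \<in> F" "l+1 \<notin> A" "x \<in> A" "x \<in> {1..l}" "insert (l+1) (A - {x}) \<notin> F"
  shows "A \<inter> {l+2..n} \<in> tails (card (A \<inter> {1..l}))"
proof -
  let ?T = "A \<inter> {l+2..n}" and ?X = "A \<inter> {1..l}"
  have cover: "y \<in> {1..l} \<or> y \<in> {l+2..n}" if "y \<in> A" for y
  proof -
    have "y \<in> {1..n}" "y \<noteq> l+1" using F_mem[OF assms(1)] assms(2) that by blast+
    then show ?thesis by auto
  qed
  then have split: "?X \<union> ?T = A" by blast
  have i1: "1 \<le> card ?X" using assms(3,4) by (metis IntI One_nat_def Suc_leI card_gt_0_iff empty_iff finite_Int finite_atLeastAtMost)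
  have i2: "card ?X \<le> l" using card_mono[of "{1..l}" ?X] by simp
  have "X \<union> ?T \<in> F" if "X \<subseteq> {1..l}" "card X = card ?X" for X
    by (rule prefix_symmetry[of ?X X ?T]) (use that split assms(1) in auto)
  moreover have "insert (l+1) (Y \<union> ?T) \<notin> F" if Y: "Y \<subseteq> {1..l}" "card Y = card ?X - 1" for Y
  proof
    assume "insert (l+1) (Y \<union> ?T) \<in> F"
    then have "Y \<union> insert (l+1) ?T \<in> F" by simp
    moreover have "card (?X - {x}) = card ?X - 1" using assms(3,4) by simp
    ultimately have "(?X - {x}) \<union> insert (l+1) ?T \<in> F"
      by (intro prefix_symmetry[of Y "?X - {x}" "insert (l+1) ?T"]) (use Y in auto)
    moreover have "(?X - {x}) \<union> insert (l+1) ?T = insert (l+1) (?X \<union> ?T - {x})"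
      using assms(4) by auto
    then have "(?X - {x}) \<union> insert (l+1) ?T = insert (l+1) (A - {x})" unfolding split .
    ultimately show False using assms(5) by simp
  qed
  ultimately show ?thesis using i1 i2 by (auto simp: tails_def)
qed

text \<open>The pushed set is compared with its unpushed versions
  \<open>insert x Y \<union> T\<close> in \<open>F\<close>. If \<open>B\<close> contains
  \<open>l + 1\<close>, this point makes up for the loss of \<open>x\<close>. Otherwise an
  \<open>x\<close> outside \<open>B\<close> is best, as nothing is lost then.\<close>

lemma pushed_inter_unpushable:
  assumes T: "T \<in> tails i" and Y: "Y \<subseteq> {1..l}" "card Y = i - 1" and B: "B \<in> F"
    and nB: "\<not> (l+1 \<notin> B \<and> B \<inter> {l+2..n} \<in> tails (card (B \<inter> {1..l})))"
  shows "t \<le> card (insert (l+1) (Y \<union> T) \<inter> B)"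
proof -
  note T' = tailsD[OF T]
  have fY: "finite Y" using Y finite_subset by blast
  have fB: "finite B" using F_mem B by blast
  have "Y \<noteq> {1..l}" using Y T' by auto
  then obtain x where x: "x \<in> {1..l}" "x \<notin> Y" using Y by blast
  have full: "insert x Y \<union> T \<in> F" if "x \<in> {1..l}" "x \<notin> Y" for x
    using T'(5)[of "insert x Y"] that Y T' fY by auto
  have Tl: "l+1 \<notin> T" "\<And>x. x \<in> {1..l} \<Longrightarrow> x \<notin> T" "l + 1 \<notin> Y" using T'(1) Y by auto
  show ?thesis
  proof (cases "l+1 \<in> B")
    case True
    let ?C = "(Y \<union> T) \<inter> B"
    have "(insert x Y \<union> T) \<inter> B \<subseteq> insert x ?C" by blast
    then have "card ((insert x Y \<union> T) \<inter> B) \<le> card (insert x ?C)" using fB by (intro card_mono) auto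
    also have "\<dots> \<le> Suc (card ?C)" by (rule card_insert_le_m1) auto
    also have "\<dots> = card (insert (l+1) ?C)" using Tl fB by auto
    also have "insert (l+1) ?C = insert (l+1) (Y \<union> T) \<inter> B" using True by blast
    finally show ?thesis using F_int[OF full[OF x] B] by linarith
  next
    case False
    show ?thesis
    proof (cases "\<exists>x\<in>{1..l}. x \<notin> Y \<and> x \<notin> B")
      case True
      then obtain x where x: "x \<in> {1..l}" "x \<notin> Y" "x \<notin> B" by blast
      have "(insert x Y \<union> T) \<inter> B = insert (l+1) (Y \<union> T) \<inter> B" using x False by blast
      then show ?thesis using F_int[OF full[OF x(1,2)] B] by simp
    next
      case F2: False
      then have "x \<in> B" using x by blast
      \<comment> \<open>Every free \<open>x\<close> lies in \<open>B\<close>. Since \<open>B\<close>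
        witnesses no asymmetry, it can itself be pushed inside \<open>F\<close>, and the pushed
        \<open>B\<close> no longer profits from \<open>x\<close>.\<close>
      then have "insert (l+1) (B - {x}) \<in> F"
        using tailsI[OF B False] x nB False by blast
      from F_int[OF full[OF x] this]
      have "t \<le> card ((insert x Y \<union> T) \<inter> insert (l+1) (B - {x}))" .
      also have "(insert x Y \<union> T) \<inter> insert (l+1) (B - {x}) = insert (l+1) (Y \<union> T) \<inter> B"
        using x Tl False by auto
      finally show ?thesis .
    qed
  qed
qed

text \<open>If the tails meet in \<open>y\<close>, moving \<open>y\<close> down to \<open>l + 1\<close> in one of the two sets costs one common
  element. Hence pushed sets can clash only for disjoint tails with \<open>i + j = l + t\<close>.\<close>

lemma tails_inter:
  assumes T: "T \<in> tails i" and S: "S \<in> tails j"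
  shows "t \<le> (i + j - l) + card (T \<inter> S)"
    "T \<inter> S \<noteq> {} \<Longrightarrow> t + 1 \<le> (i + j - l) + card (T \<inter> S)"
proof -
  note T' = tailsD[OF T] and S' = tailsD[OF S]
  obtain X where X: "X \<subseteq> {1..l}" "card X = i"
    using T'(3) obtain_subset_with_card_n[of i "{1..l}"] by auto
  \<comment> \<open>By symmetry any prefix of size \<open>j\<close> may accompany \<open>S\<close>,
    so the one meeting \<open>X\<close> least is taken.\<close>
  obtain Y where Y: "Y \<subseteq> {1..l}" "card Y = j" "card (X \<inter> Y) = i + j - l"
    using ex_min_intersection[of "{1..l}" X j] X S'(3) by auto
  have fX: "finite X" "finite Y" using X Y finite_subset by blast+
  have d: "X \<inter> S = {}" "T \<inter> Y = {}" "l+1 \<notin> X" "l+1 \<notin> Y" "l+1 \<notin> T" "l+1 \<notin> S" "X \<inter> T = {}" using X Y T'(1) S'(1) by fastforce+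
  have c: "card (X \<inter> Y \<union> T' \<inter> S) = card (X \<inter> Y) + card (T' \<inter> S)" if "T' \<subseteq> T" for T'
    using d fX T'(4) that by (intro card_Un_disjoint) (auto intro: finite_subset)
  have A: "X \<union> T \<in> F" and B: "Y \<union> S \<in> F" using T' S' X Y by blast+
  have "(X \<union> T) \<inter> (Y \<union> S) = X \<inter> Y \<union> T \<inter> S" using d by blast
  then show "t \<le> (i + j - l) + card (T \<inter> S)"
    using F_int[OF A B] c[of T] Y by simp
  assume "T \<inter> S \<noteq> {}"
  then obtain y where y: "y \<in> T" "y \<in> S" by blast
  have "l + 1 < y" "y \<le> n" using y T'(1) by auto
  then have "exchange_closed F (l+1) y" using left unfolding left_compressed_def by auto
  then have "insert (l+1) (X \<union> T - {y}) \<in> F"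
    using A y d by (intro exchange_closedD) auto
  from F_int[OF this B]
  have "t \<le> card (insert (l+1) (X \<union> T - {y}) \<inter> (Y \<union> S))" .
  also have "insert (l+1) (X \<union> T - {y}) \<inter> (Y \<union> S) = X \<inter> Y \<union> (T - {y}) \<inter> S" using d y by blast
  also have "card \<dots> = (i + j - l) + card ((T - {y}) \<inter> S)" using c[of "T - {y}"] Y by auto
  also have "(T - {y}) \<inter> S = T \<inter> S - {y}" by blast
  also have "card (T \<inter> S - {y}) = card (T \<inter> S) - 1" using y by simp
  finally have "t \<le> (i + j - l) + (card (T \<inter> S) - 1)" .
  moreover have "card (T \<inter> S) > 0" using y T'(4) by (auto simp: card_gt_0_iff)
  ultimately show "t + 1 \<le> (i + j - l) + card (T \<inter> S)" by linarith
qed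

text \<open>Pushing lowers the guaranteed overlap of the prefixes by at most one per pushed set; if
  both are pushed, the common point \<open>l + 1\<close> returns one. So one spare common element is
  enough.\<close>

lemma pushed_inter:
  assumes T: "T \<in> tails i" and S: "S \<in> tails j" and ne: "i + j \<noteq> l + t \<or> T \<inter> S \<noteq> {}"
    and X: "X \<subseteq> {1..l}" "card X = i - 1" and Y: "Y \<subseteq> {1..l}"
  shows "card Y = j \<Longrightarrow> t \<le> card (insert (l+1) (X \<union> T) \<inter> (Y \<union> S))"
    and "card Y = j - 1 \<Longrightarrow> t \<le> card (insert (l+1) (X \<union> T) \<inter> insert (l+1) (Y \<union> S))"
proof -
  note T' = tailsD[OF T] and S' = tailsD[OF S]
  have fX: "finite X" "finite Y" using X Y finite_subset by blast+
  have d: "X \<inter> S = {}" "T \<inter> Y = {}" "l+1 \<notin> X" "l+1 \<notin> Y" "l+1 \<notin> T" "l+1 \<notin> S" using X Y T'(1) S'(1) by fastforce+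
  have c: "card (X \<inter> Y \<union> T \<inter> S) = card (X \<inter> Y) + card (T \<inter> S)"
    using d fX T'(4) by (intro card_Un_disjoint) auto
  have m: "card X + card Y - l \<le> card (X \<inter> Y)"
    using card_inter_ge[of "{1..l}" X Y] X Y by simp
  \<comment> \<open>The spare element comes from \<open>tails_inter\<close> if the tails meet, and
    from i + j > l + t if they are disjoint.\<close>
  have s: "(T \<inter> S = {} \<and> i + j \<noteq> l + t \<and> card (T \<inter> S) = 0 \<and> t \<le> i + j - l) \<or>
     t + 1 \<le> (i + j - l) + card (T \<inter> S) \<and> 1 \<le> card (T \<inter> S)"
    using tails_inter[OF T S] ne T'(4) by (cases "T \<inter> S = {}") (auto simp: card_gt_0_iff Suc_le_eq)
  { assume "card Y = j"
    moreover have "insert (l+1) (X \<union> T) \<inter> (Y \<union> S) = X \<inter> Y \<union> T \<inter> S" using d by blast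
    ultimately show "t \<le> card (insert (l+1) (X \<union> T) \<inter> (Y \<union> S))"
      using c m s X T'(2) t_pos by auto }
  { assume "card Y = j - 1"
    moreover have "insert (l+1) (X \<union> T) \<inter> insert (l+1) (Y \<union> S) = insert (l+1) (X \<inter> Y \<union> T \<inter> S)" using d by blast
    moreover have "card (insert (l+1) (X \<inter> Y \<union> T \<inter> S)) = Suc (card (X \<inter> Y \<union> T \<inter> S))"
      using d fX T'(4) by (intro card_insert_disjoint) auto
    ultimately show "t \<le> card (insert (l+1) (X \<union> T) \<inter> insert (l+1) (Y \<union> S))"
      using c m s X T'(2) S'(2) t_pos by auto }
qed

section \<open>Trading blocks against pushed blocks\<close>

lemma card_block:
  assumes "U \<subseteq> tails i"
  shows "card (block i U) = (l choose i) * card U"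
proof -
  have "inj_on (\<lambda>(X, T). X \<union> T) ({X. X \<subseteq> {1..l} \<and> card X = i} \<times> U)"
  proof (rule inj_onI, clarsimp)
    fix X T Y S assume *: "X \<subseteq> {Suc 0..l}" "T \<in> U" "Y \<subseteq> {Suc 0..l}" "S \<in> U" "X \<union> T = Y \<union> S"
    have "T \<subseteq> {l+2..n}" "S \<subseteq> {l+2..n}" using * assms tailsD(1) by blast+
    then have "T \<inter> {Suc 0..l} = {}" "S \<inter> {Suc 0..l} = {}" by fastforce+
    then show "X = Y \<and> T = S" using * by blast
  qed
  then show ?thesis
    unfolding block_def using n_subsets[of "{1..l}" i] by (simp add: card_image card_cartesian_product)
qed

lemma card_pushed_block:
  assumes "U \<subseteq> tails i"
  shows "card (pushed_block i U) = (l choose (i - 1)) * card U"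
proof -
  have "inj_on (\<lambda>(X, T). insert (l+1) (X \<union> T)) ({X. X \<subseteq> {1..l} \<and> card X = i - 1} \<times> U)"
  proof (rule inj_onI, clarify)
    fix X T Y S assume *: "X \<subseteq> {1..l}" "T \<in> U" "Y \<subseteq> {1..l}" "S \<in> U" "insert (l+1) (X \<union> T) = insert (l+1) (Y \<union> S)"
    have "T \<subseteq> {l+2..n}" "S \<subseteq> {l+2..n}" using * assms tailsD(1) by blast+
    then have "T \<inter> {1..l} = {}" "S \<inter> {1..l} = {}" "l+1 \<notin> T" "l+1 \<notin> S" by fastforce+
    moreover have "l+1 \<notin> X" "l+1 \<notin> Y" using * by auto
    ultimately have "insert (l+1) (X \<union> T) \<inter> {1..l} = X" "insert (l+1) (Y \<union> S) \<inter> {1..l} = Y"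
      "insert (l+1) (X \<union> T) - {1..l} - {l+1} = T" "insert (l+1) (Y \<union> S) - {1..l} - {l+1} = S"
      using *(1,3) by auto
    then show "X = Y \<and> T = S" using *(5) by metis
  qed
  then show ?thesis
    unfolding pushed_block_def using n_subsets[of "{1..l}" "i - 1"] by (simp add: card_image card_cartesian_product)
qed

lemma block_subset: "U \<subseteq> tails i \<Longrightarrow> block i U \<subseteq> F"
proof
  fix A assume "U \<subseteq> tails i" "A \<in> block i U"
  then obtain X T where "A = X \<union> T" "X \<subseteq> {1..l}" "card X = i" "T \<in> tails i"
    unfolding block_def by auto
  then show "A \<in> F" using tailsD(5)[of T i X] by simp
qed

lemma pushed_block_disjoint: "U \<subseteq> tails i \<Longrightarrow> pushed_block i U \<inter> F = {}"
proof -
  assume U: "U \<subseteq> tails i"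
  have "A \<notin> F" if A: "A \<in> pushed_block i U" for A
  proof -
    obtain X T where "A = insert (l+1) (X \<union> T)" "X \<subseteq> {1..l}" "card X = i - 1" "T \<in> tails i"
      using A U unfolding pushed_block_def by auto
    then show "A \<notin> F" using tailsD(6)[of T i X] by simp
  qed
  then show ?thesis by blast
qed

lemma pushed_block_k_sets:
  assumes "U \<subseteq> tails i" shows "pushed_block i U \<subseteq> k_sets n k"
proof
  fix A assume "A \<in> pushed_block i U"
  then obtain X T where A: "A = insert (l+1) (X \<union> T)" "X \<subseteq> {1..l}" "card X = i - 1" "T \<in> tails i"
    using assms unfolding pushed_block_def by auto
  note T' = tailsD[OF A(4)]
  have fin: "finite X" using A(2) finite_subset by blast
  have "X \<inter> T = {}" using A(2) T'(1) by fastforce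
  then have "card (X \<union> T) = card X + card T" using fin T'(4) by (intro card_Un_disjoint)
  moreover have "l+1 \<notin> X \<union> T" using A(2) T'(1) by fastforce
  moreover have "finite (X \<union> T)" using fin T'(4) by simp
  ultimately have "card A = k" using A(1,3) card_tail[OF A(4)] T'(2) by simp
  moreover have "A \<subseteq> {1..n}" using A(1,2) T'(1) l_less by fastforce
  ultimately show "A \<in> k_sets n k" by (simp add: k_sets_def)
qed

text \<open>\<open>added\<close> and \<open>kept\<close> exclude the only possible clashes, those
  between disjoint tails at levels adding up to \<open>l + t\<close>. The new family therefore
  competes with the optimal \<open>F\<close>, which turns the size equation into the final
  inequality.\<close>

lemma push_pull:
  assumes UA: "UA \<subseteq> tails i" and UR: "UR \<subseteq> tails j"
    and added: "\<And>T S. T \<in> UA \<Longrightarrow> S \<in> UA \<Longrightarrow> i + i \<noteq> l + t \<or> T \<inter> S \<noteq> {}"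
    and kept: "\<And>T S j'. T \<in> UA \<Longrightarrow> S \<in> tails j' \<Longrightarrow> \<not> (j' = j \<and> S \<in> UR) \<Longrightarrow> i + j' \<noteq> l + t \<or> T \<inter> S \<noteq> {}"
  defines "G \<equiv> (F - block j UR) \<union> pushed_block i UA"
  shows "intersecting n k t G"
    and "card G + (l choose j) * card UR = card F + (l choose (i - 1)) * card UA"
    and "(l choose (i - 1)) * card UA \<le> (l choose j) * card UR"
proof -
  have AF: "t \<le> card (A \<inter> B)" if A: "A \<in> pushed_block i UA" and B: "B \<in> F" "B \<notin> block j UR" for A B
  proof -
    obtain X T where A: "A = insert (l+1) (X \<union> T)" "X \<subseteq> {1..l}" "card X = i - 1" "T \<in> UA"
      using A unfolding pushed_block_def by auto
    then have T: "T \<in> tails i" using UA by blast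
    show ?thesis
    proof (cases "l+1 \<notin> B \<and> B \<inter> {l+2..n} \<in> tails (card (B \<inter> {1..l}))")
      case True
      let ?S = "B \<inter> {l+2..n}" and ?Y = "B \<inter> {1..l}"
      have "y \<in> {1..l} \<or> y = l+1 \<or> y \<in> {l+2..n}" if "y \<in> B" for y
      proof -
        have "y \<in> {1..n}" using F_mem[OF B(1)] that by blast
        then show ?thesis by auto
      qed
      then have split: "?Y \<union> ?S = B" using True by blast
      have "\<not> (card ?Y = j \<and> ?S \<in> UR)"
      proof
        assume "card ?Y = j \<and> ?S \<in> UR"
        then have "?Y \<union> ?S \<in> block j UR" unfolding block_def by auto
        then show False using split B(2) by simp
      qed
      then have "i + card ?Y \<noteq> l + t \<or> T \<inter> ?S \<noteq> {}" using kept[OF A(4)] True by blast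
      then have "t \<le> card (A \<inter> (?Y \<union> ?S))"
        unfolding A(1) using True by (intro pushed_inter(1)[OF T _ _ A(2,3)]) auto
      then show ?thesis unfolding split .
    next
      case False
      then show ?thesis using pushed_inter_unpushable[OF T A(2,3) B(1)] A(1) by blast
    qed
  qed
  have AA: "t \<le> card (A \<inter> B)" if A: "A \<in> pushed_block i UA" and B: "B \<in> pushed_block i UA" for A B
  proof -
    obtain X T where A: "A = insert (l+1) (X \<union> T)" "X \<subseteq> {1..l}" "card X = i - 1" "T \<in> UA"
      using A unfolding pushed_block_def by auto
    obtain Y S where B: "B = insert (l+1) (Y \<union> S)" "Y \<subseteq> {1..l}" "card Y = i - 1" "S \<in> UA"
      using B unfolding pushed_block_def by auto
    show ?thesis
      unfolding A(1) B(1) using pushed_inter(2)[OF _ _ added[OF A(4) B(4)] A(2,3) B(2,3)] UA A B by blast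
  qed
  show G: "intersecting n k t G"
    unfolding intersecting_def
  proof (intro conjI ballI)
    show "G \<subseteq> k_sets n k"
      using opt pushed_block_k_sets[OF UA] unfolding G_def optimal_def intersecting_def by blast
    show "t \<le> card (A \<inter> B)" if "A \<in> G" "B \<in> G" for A B
      using that F_int AF[of A B] AF[of B A] AA unfolding G_def by (auto simp: Int_commute)
  qed
  have fin: "finite (pushed_block i UA)"
    using pushed_block_k_sets[OF UA] finite_subset finite_k_sets by blast
  have "card G = card (F - block j UR) + card (pushed_block i UA)"
    unfolding G_def using finite_F fin pushed_block_disjoint[OF UA] by (intro card_Un_disjoint) auto
  moreover have "card (F - block j UR) + card (block j UR) = card F"
    using block_subset[OF UR] finite_F by (metis add.commute card_Diff_subset card_mono finite_subset le_add_diff_inverse)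
  ultimately show e: "card G + (l choose j) * card UR = card F + (l choose (i - 1)) * card UA"
    using card_block[OF UR] card_pushed_block[OF UA] by simp
  have "card G \<le> card F" using G opt unfolding optimal_def by blast
  then show "(l choose (i - 1)) * card UA \<le> (l choose j) * card UR" using e by linarith
qed

end

lemma binomial_step: "0 < i \<Longrightarrow> i \<le> l \<Longrightarrow> i * (l choose i) = (l + 1 - i) * (l choose (i - 1))"
  using binomial_absorb_comp[of l "i - 1"] binomial_absorption[of "i - 1" l]
  by (cases i) (auto simp: Suc_diff_le binomial_absorption mult.commute)

context symmetric_prefix
begin

text \<open>Trading the block at level \<open>l + t - i\<close> for the pushed block at level \<open>i\<close>, or vice versa, would
  enlarge \<open>F\<close>.\<close>

lemma tails_off_diagonal:
  assumes t: "2 \<le> t" and i: "i + i \<noteq> l + t"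
  shows "tails i = {}"
proof (rule ccontr)
  assume ne: "tails i \<noteq> {}"
  then have il: "1 \<le> i" "i \<le> l" using tailsD by blast+
  define j where "j = l + t - i"
  have ij: "i + j = l + t" "j \<noteq> i" using il i unfolding j_def by auto
  then have jj: "j + j \<noteq> l + t" by linarith
  have j': "j' = j" if "i + j' = l + t" for j' using that ij by linarith
  have i': "i' = i" if "j + i' = l + t" for i' using that ij by linarith
  have "(l choose (i - 1)) * card (tails i) \<le> (l choose j) * card (tails j)"
    by (rule push_pull(3)) (use i j' in auto)
  moreover have pos: "(l choose (i - 1)) > 0" "card (tails i) > 0"
    using il ne finite_tails by (auto simp: card_gt_0_iff)
  \<comment> \<open>The partner level is nonempty too, so the opposite trade is also
    possible.\<close>
  ultimately have p2: "(l choose j) > 0" "card (tails j) > 0"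
    by (metis gr0I mult_is_0 not_le mult_pos_pos)+
  then have jl: "1 \<le> j" "j \<le> l" using tailsD(2,3) by (metis card.empty equals0I gr_implies_not0)+
  have "(l choose (j - 1)) * card (tails j) \<le> (l choose i) * card (tails i)"
    by (rule push_pull(3)) (use jj i' in auto)
  \<comment> \<open>In the product of the two inequalities the numbers of tails cancel and only
    binomials remain.\<close>
  then have "((l choose (j - 1)) * card (tails j)) * ((l choose (i - 1)) * card (tails i))
     \<le> ((l choose i) * card (tails i)) * ((l choose j) * card (tails j))"
    using \<open>(l choose (i - 1)) * card (tails i) \<le> (l choose j) * card (tails j)\<close> by (rule mult_le_mono)
  then have "((l choose (j - 1)) * (l choose (i - 1))) * (card (tails i) * card (tails j))
     \<le> ((l choose i) * (l choose j)) * (card (tails i) * card (tails j))"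
    by (simp only: ac_simps)
  then have le: "(l choose (j - 1)) * (l choose (i - 1)) \<le> (l choose i) * (l choose j)"
    using pos p2 by simp
  have "(i * (l choose i)) * (j * (l choose j)) =
      ((l + 1 - i) * (l + 1 - j)) * ((l choose (i - 1)) * (l choose (j - 1)))"
    using binomial_step[of i l] binomial_step[of j l] il jl by (simp add: ac_simps)
  also have "\<dots> < (j * i) * ((l choose (i - 1)) * (l choose (j - 1)))"
  proof (rule mult_strict_right_mono)
    \<comment> \<open>Since i + j = l + t, the factors on the left are j + 1 - t and i + 1 - t,
      smaller than j and i because t >= 2.\<close>
    show "(l + 1 - i) * (l + 1 - j) < j * i"
      using il jl ij t by (intro mult_strict_mono) auto
    show "0 < (l choose (i - 1)) * (l choose (j - 1))" using il jl by auto
  qed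
  also have "\<dots> \<le> (j * i) * ((l choose i) * (l choose j))"
    using le by (intro mult_left_mono) (simp_all add: mult.commute)
  also have "\<dots> = (i * (l choose i)) * (j * (l choose j))" by (simp add: ac_simps)
  finally show False by simp
qed

section \<open>The diagonal level with 2i = l + t\<close>

abbreviation "tails_with i m \<equiv> {T \<in> tails i. m \<in> T}"
abbreviation "tails_without i m \<equiv> {T \<in> tails i. m \<notin> T}"

definition pulled :: "nat \<Rightarrow> nat \<Rightarrow> nat set set" where
  "pulled i m = (F - block i (tails_without i m)) \<union> pushed_block i (tails_with i m)"

text \<open>Level \<open>i\<close> is its own partner here. All tails that remain at this level
  contain \<open>m\<close>, so no two of them are disjoint and \<open>push_pull\<close>
  applies.\<close>

lemma pulled:
  assumes "i + i = l + t"
  shows "intersecting n k t (pulled i m)"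
    and "card (pulled i m) + (l choose i) * card (tails_without i m) =
         card F + (l choose (i - 1)) * card (tails_with i m)"
    and "(l choose (i - 1)) * card (tails_with i m) \<le> (l choose i) * card (tails_without i m)"
proof -
  have i': "i' = i" if "i + i' = l + t" for i' using that assms by linarith
  have sub: "tails_with i m \<subseteq> tails i" "tails_without i m \<subseteq> tails i" by auto
  have added: "i + i \<noteq> l + t \<or> T \<inter> S \<noteq> {}" if "T \<in> tails_with i m" "S \<in> tails_with i m" for T S
    using that by blast
  have kept: "i + j' \<noteq> l + t \<or> T \<inter> S \<noteq> {}"
    if "T \<in> tails_with i m" "S \<in> tails j'" "\<not> (j' = i \<and> S \<in> tails_without i m)" for T S j'
    using that i' by blast
  note pp = push_pull[OF sub added kept, folded pulled_def]
  show "intersecting n k t (pulled i m)" by (rule pp(1))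
  show "card (pulled i m) + (l choose i) * card (tails_without i m) =
         card F + (l choose (i - 1)) * card (tails_with i m)" by (rule pp(2))
  show "(l choose (i - 1)) * card (tails_with i m) \<le> (l choose i) * card (tails_without i m)"
    by (rule pp(3))
qed

text \<open>Averaging the third part of the previous lemma over all \<open>m\<close> beyond \<open>l + 1\<close>. With \<open>a = t - 1\<close>,
  \<open>a' = n - 2k + t - 1\<close>, \<open>d = k - t + 1\<close> and \<open>q = i - t + 1\<close> it reads \<open>a d \<le> q (a + a')\<close>; integers
  are used since \<open>a'\<close> may be negative here.\<close>

lemma diagonal_inequality:
  assumes i: "i + i = l + t" and ne: "tails i \<noteq> {}"
  shows "int (i - t + 1) * (int n + 2 * int t - 2 * int k - 2) \<ge> (int t - 1) * (int k - int t + 1)"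
    and "int (i - t + 1) * (int n + 2 * int t - 2 * int k - 2) = (int t - 1) * (int k - int t + 1) \<Longrightarrow>
      m \<in> {l+2..n} \<Longrightarrow>
      (l choose (i - 1)) * card (tails_with i m) = (l choose i) * card (tails_without i m)"
proof -
  obtain T where T: "T \<in> tails i" using ne by blast
  note T' = tailsD[OF T]
  define c where "c = k - i"
  have ck: "card T = c" "k = i + c" using card_tail[OF T] unfolding c_def by auto
  let ?R = "{l+2..n}" and ?U = "card (tails i)"
  have "c \<le> card ?R" using card_mono[of ?R T] T'(1) ck by simp
  then have "n = l + 1 + c + (n - l - 1 - c)" using l_less by simp
  then obtain d where d: "n = l + 1 + c + d" by blast
  have tail_k: "S \<subseteq> ?R \<and> card S = c" if "S \<in> tails i" for S
    using tailsD(1)[OF that] card_tail[OF that] ck by simp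
  \<comment> \<open>All tails at level \<open>i\<close> have \<open>c\<close> points among the
    \<open>c + d\<close> points beyond \<open>l + 1\<close>: each is counted \<open>c\<close> times
    here, and \<open>d\<close> times among the tails that avoid \<open>m\<close>.\<close>
  have sum1: "(\<Sum>m\<in>?R. card (tails_with i m)) = c * ?U"
  proof (rule sum_multicount[OF _ finite_tails])
    have "{m \<in> ?R. m \<in> S} = S" if "S \<in> tails i" for S using tail_k[OF that] by blast
    then show "\<forall>S\<in>tails i. card {m \<in> ?R. m \<in> S} = c" using tail_k by simp
  qed simp
  have split: "card (tails_with i m) + card (tails_without i m) = ?U" for m
  proof -
    have "tails_with i m \<union> tails_without i m = tails i" by blast
    moreover have "card (tails_with i m \<union> tails_without i m) = card (tails_with i m) + card (tails_without i m)"
      using finite_tails by (intro card_Un_disjoint) auto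
    ultimately show ?thesis by simp
  qed
  have "(\<Sum>m\<in>?R. card (tails_with i m)) + (\<Sum>m\<in>?R. card (tails_without i m)) = (c + d) * ?U"
    unfolding sum.distrib[symmetric] split using d by simp
  then have sum2: "(\<Sum>m\<in>?R. card (tails_without i m)) = d * ?U" using sum1 by (simp add: algebra_simps)
  have each: "(l choose (i - 1)) * card (tails_with i m) \<le> (l choose i) * card (tails_without i m)" for m
    by (rule pulled(3)[OF i])
  have tot: "(\<Sum>m\<in>?R. (l choose (i - 1)) * card (tails_with i m)) = (l choose (i - 1)) * (c * ?U)"
    "(\<Sum>m\<in>?R. (l choose i) * card (tails_without i m)) = (l choose i) * (d * ?U)"
    by (simp_all only: sum_distrib_left[symmetric] sum1 sum2)
  have U: "?U > 0" using ne finite_tails by (auto simp: card_gt_0_iff)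
  have t_le: "t \<le> i" using i T'(3) by linarith
  define q where "q = i - t + 1"
  have lq: "l + 1 - i = q" using i t_le unfolding q_def by linarith
  have bs: "i * (l choose i) = q * (l choose (i - 1))" using binomial_step[of i l] T'(2,3) lq by simp
  have lhs: "i * ((l choose (i - 1)) * (c * ?U)) = (i * c) * ((l choose (i - 1)) * ?U)" by (simp add: ac_simps)
  have rhs: "i * ((l choose i) * (d * ?U)) = (q * d) * ((l choose (i - 1)) * ?U)"
  proof -
    have "i * ((l choose i) * (d * ?U)) = (i * (l choose i)) * (d * ?U)" by (simp only: ac_simps)
    also have "\<dots> = (q * d) * ((l choose (i - 1)) * ?U)" unfolding bs by (simp only: ac_simps)
    finally show ?thesis .
  qed
  have pos: "(l choose (i - 1)) * ?U > 0" using U T'(2,3) by simp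
  have "(l choose (i - 1)) * (c * ?U) \<le> (l choose i) * (d * ?U)"
    unfolding tot[symmetric] by (intro sum_mono each)
  then have "i * ((l choose (i - 1)) * (c * ?U)) \<le> i * ((l choose i) * (d * ?U))" by simp
  then have le: "i * c \<le> q * d" unfolding lhs rhs using pos by simp
  have iq: "int i = int q + int t - 1" using t_le unfolding q_def by simp
  have nn: "int n = 2 * int i - int t + 1 + int c + int d" using d i by linarith
  \<comment> \<open>Here n + 2t - 2k - 2 = (t - 1) + d - c and k - t + 1 = q + c, while i = q + t -
    1.\<close>
  have arith: "int q * (int n + 2 * int t - 2 * int k - 2) - (int t - 1) * (int k - int t + 1)
     = int (q * d) - int (i * c)"
    unfolding nn ck(2) of_nat_add of_nat_mult iq by (simp add: algebra_simps)
  show "int (i - t + 1) * (int n + 2 * int t - 2 * int k - 2) \<ge> (int t - 1) * (int k - int t + 1)"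
    using arith le unfolding q_def[symmetric] by linarith
  assume "int (i - t + 1) * (int n + 2 * int t - 2 * int k - 2) = (int t - 1) * (int k - int t + 1)"
    and m: "m \<in> ?R"
  then have "i * c = q * d" using arith unfolding q_def[symmetric] by linarith
  then have "i * ((l choose (i - 1)) * (c * ?U)) = i * ((l choose i) * (d * ?U))" unfolding lhs rhs by simp
  then have eq: "(l choose (i - 1)) * (c * ?U) = (l choose i) * (d * ?U)" using T'(2) by simp
  \<comment> \<open>Equal sums of termwise ordered numbers are termwise equal.\<close>
  show "(l choose (i - 1)) * card (tails_with i m) = (l choose i) * card (tails_without i m)"
    by (rule sum_mono_inv[OF eq[folded tot] each m]) simp
qed

lemma symmetric_step:
  assumes "\<And>i. tails i = {}"
  shows "symmetric_on {1..l+1} F"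
proof -
  have "insert x (A - {y}) \<in> F" if xy: "x \<in> {1..l+1}" "y \<in> {1..l+1}" and A: "A \<in> F" "y \<in> A" "x \<notin> A" for x y A
  proof -
    have "x \<noteq> y" using A by blast
    then consider "x \<in> {1..l}" "y \<in> {1..l}" | "x < y" | "x = l+1" "y \<in> {1..l}"
      using xy by (fastforce simp: le_Suc_eq)
    then show ?thesis
    proof cases
      case 1
      then show ?thesis using sym A exchange_closedD unfolding symmetric_on_def by blast
    next
      case 2
      have "exchange_closed F x y" using 2 left xy l_less unfolding left_compressed_def by auto
      then show ?thesis using A exchange_closedD by blast
    next
      case 3
      then show ?thesis using tailsI[of A y] A assms by blast
    qed
  qed
  then show ?thesis unfolding symmetric_on_def exchange_closed_def by blast
qed

end

section \<open>Extremal families\<close>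

text \<open>The summand \<open>n * n + 1\<close> dominates every sum of elements, so that the number of elements beyond
  \<open>q\<close> is compared first.\<close>

definition weight :: "nat \<Rightarrow> nat \<Rightarrow> nat set \<Rightarrow> nat" where
  "weight n q A = \<Sum>A + (n * n + 1) * card (A \<inter> {q+1..n})"

definition potential :: "nat \<Rightarrow> nat \<Rightarrow> nat set set \<Rightarrow> nat" where
  "potential n q F = (\<Sum>A\<in>F. weight n q A)"

text \<open>Minimal potential serves two ends: it forces left-compression, and it decides the case
  where averaging gives equality only.\<close>

definition extremal :: "nat \<Rightarrow> nat \<Rightarrow> nat \<Rightarrow> nat \<Rightarrow> nat set set \<Rightarrow> bool" where
  "extremal n k t q F \<longleftrightarrow>
     optimal n k t F \<and> (\<forall>G. optimal n k t G \<longrightarrow> potential n q F \<le> potential n q G)"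

lemma ex_extremal: "\<exists>F. extremal n k t q F"
proof -
  have "intersecting n k t {}" by (simp add: intersecting_def)
  moreover have "card G \<le> n choose k" if "intersecting n k t G" for G
    using that card_mono[OF finite_k_sets, of G n k] unfolding intersecting_def card_k_sets by blast
  ultimately have "\<exists>F. intersecting n k t F \<and> (\<forall>G. intersecting n k t G \<longrightarrow> card G \<le> card F)"
    by (intro ex_has_greatest_nat[where b = "Suc (n choose k)"]) (auto simp: less_Suc_eq_le)
  then obtain F where "optimal n k t F" unfolding optimal_def by blast
  then show ?thesis
    unfolding extremal_def using ex_has_least_nat[of "optimal n k t" F "potential n q"] by blast
qed

lemma weight_exchange:
  assumes "A \<subseteq> {1..n}" "x < y" "y \<in> A" "x \<notin> A"
  shows "weight n q (insert x (A - {y})) < weight n q A"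
proof -
  have fin: "finite A" using assms finite_subset by blast
  have "\<Sum>(insert x (A - {y})) = x + \<Sum>(A - {y})" using fin assms by simp
  moreover have "\<Sum>A = y + \<Sum>(A - {y})" using fin assms by (simp add: sum.remove)
  moreover have "card (insert x (A - {y}) \<inter> {q+1..n}) \<le> card (A \<inter> {q+1..n})"
  proof (cases "x \<in> {q+1..n}")
    case True
    then have "y \<in> {q+1..n}" using assms by auto
    moreover have "insert x (A - {y}) \<inter> {q+1..n} = insert x (A \<inter> {q+1..n} - {y})" using True by blast
    ultimately show ?thesis using card_exchange[of "A \<inter> {q+1..n}" y x] assms fin by auto
  next
    case False
    then show ?thesis using fin by (intro card_mono) auto
  qed
  ultimately show ?thesis unfolding weight_def using assms(2)
    by (metis add_less_le_mono add_less_mono1 mult_le_mono2)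
qed

section \<open>Left-compression by shifts\<close>

definition shift :: "nat set set \<Rightarrow> nat \<Rightarrow> nat \<Rightarrow> nat set \<Rightarrow> nat set" where
  "shift F x y A = (if y \<in> A \<and> x \<notin> A \<and> insert x (A - {y}) \<notin> F then insert x (A - {y}) else A)"

text \<open>The delicate \<open>B\<close> is one that stays because
  \<open>insert x (B - {y})\<close> is already in \<open>F\<close>. Then \<open>A\<close> meets that
  member in exactly the set in which the shifted \<open>A\<close> meets \<open>B\<close>.\<close>

lemma shift_inter:
  assumes F: "\<And>A B. A \<in> F \<Longrightarrow> B \<in> F \<Longrightarrow> t \<le> card (A \<inter> B)" "\<And>A. A \<in> F \<Longrightarrow> finite A"
    and A: "A \<in> F" and B: "B \<in> F"
    and mA: "y \<in> A \<and> x \<notin> A \<and> insert x (A - {y}) \<notin> F"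
  shows "t \<le> card (insert x (A - {y}) \<inter> shift F x y B)"
proof (cases "y \<in> B \<and> x \<notin> B")
  case True
  show ?thesis
  proof (cases "insert x (B - {y}) \<in> F")
    case False
    then have "shift F x y B = insert x (B - {y})" using True by (simp add: shift_def)
    moreover have "insert x (A - {y}) \<inter> insert x (B - {y}) = insert x (A \<inter> B - {y})" by blast
    moreover have "card (insert x (A \<inter> B - {y})) = card (A \<inter> B)"
      using F(2)[OF A] mA True by (intro card_exchange) auto
    ultimately show ?thesis using F(1)[OF A B] by simp
  next
    case inF: True
    then have "shift F x y B = B" by (simp add: shift_def)
    moreover have "insert x (A - {y}) \<inter> B = A \<inter> insert x (B - {y})" using mA True by auto
    ultimately show ?thesis using F(1)[OF A inF] by simp
  qed
next
  case False
  then have sB: "shift F x y B = B" by (auto simp: shift_def)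
  show ?thesis
  proof (cases "y \<in> B")
    case True
    then have "insert x (A - {y}) \<inter> B = insert x (A \<inter> B - {y})" using False by blast
    moreover have "card (insert x (A \<inter> B - {y})) = card (A \<inter> B)"
      using F(2)[OF A] mA True by (intro card_exchange) auto
    ultimately show ?thesis using F(1)[OF A B] sB by simp
  next
    case nB: False
    have "card (A \<inter> B) \<le> card (insert x (A - {y}) \<inter> B)" using nB F(2)[OF A] by (intro card_mono) auto
    then show ?thesis using F(1)[OF A B] sB by simp
  qed
qed

lemma intersecting_shift:
  assumes F: "intersecting n k t F" and xy: "1 \<le> x" "x < y" "y \<le> n"
  shows "intersecting n k t (shift F x y ` F)" "inj_on (shift F x y) F"
proof -
  have mem: "A \<subseteq> {1..n} \<and> card A = k \<and> finite A" if "A \<in> F" for A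
    using F k_setsD[of A n k] that unfolding intersecting_def by blast
  have fin: "finite A" if "A \<in> F" for A using mem[OF that] by blast
  have int: "t \<le> card (A \<inter> B)" if "A \<in> F" "B \<in> F" for A B
    using F that unfolding intersecting_def by blast
  have moved: "shift F x y A = A \<or> (y \<in> A \<and> x \<notin> A \<and> insert x (A - {y}) \<notin> F) \<and> shift F x y A = insert x (A - {y})" for A
    by (simp add: shift_def)
  show "intersecting n k t (shift F x y ` F)"
    unfolding intersecting_def
  proof (intro conjI ballI subsetI)
    fix A' assume "A' \<in> shift F x y ` F"
    then obtain A where A: "A \<in> F" "A' = shift F x y A" by blast
    have "x \<in> {1..n}" using xy by simp
    then have "insert x (A - {y}) \<subseteq> {1..n}" using mem[OF A(1)] by blast
    then show "A' \<in> k_sets n k"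
      using moved[of A] mem[OF A(1)] card_exchange[of A y x] unfolding A(2) k_sets_def
      by (metis (mono_tags, lifting) mem_Collect_eq)
    fix B' assume "B' \<in> shift F x y ` F"
    then obtain B where B: "B \<in> F" "B' = shift F x y B" by blast
    consider "A' = A" "B' = B" | "y \<in> A \<and> x \<notin> A \<and> insert x (A - {y}) \<notin> F" "A' = insert x (A - {y})"
      | "y \<in> B \<and> x \<notin> B \<and> insert x (B - {y}) \<notin> F" "B' = insert x (B - {y})"
      using moved[of A] moved[of B] A B by auto
    then show "t \<le> card (A' \<inter> B')"
    proof cases
      case 1
      then show ?thesis using int A B by simp
    next
      case 2
      then show ?thesis using shift_inter[OF int fin A(1) B(1), of y x] B(2) by simp
    next
      case 3
      then show ?thesis using shift_inter[OF int fin B(1) A(1), of y x] A(2) by (simp add: Int_commute)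
    qed
  qed
  show "inj_on (shift F x y) F"
  proof (rule inj_onI)
    fix A B assume *: "A \<in> F" "B \<in> F" "shift F x y A = shift F x y B"
    \<comment> \<open>Moved sets land outside \<open>F\<close> and the others stay inside, so a
      moved and an unmoved set never collide; two moved sets are recovered by undoing the
      exchange.\<close>
    have restore: "insert y (insert x (C - {y}) - {x}) = C" if "y \<in> C" "x \<notin> C" for C
      using that xy by auto
    show "A = B" using moved[of A] moved[of B] * restore[of A] restore[of B] by metis
  qed
qed

text \<open>A missing exchange would give a shift that moves some member, and the shifted family
  would be optimal with smaller potential.\<close>

lemma extremal_left_compressed:
  assumes "extremal n k t q F"
  shows "left_compressed n F"
proof (rule ccontr)
  assume "\<not> left_compressed n F"
  then obtain x y A where xy: "1 \<le> x" "x < y" "y \<le> n" and A: "A \<in> F" "y \<in> A" "x \<notin> A" "insert x (A - {y}) \<notin> F"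
    unfolding left_compressed_def exchange_closed_def by blast
  have opt: "optimal n k t F" using assms extremal_def by blast
  then have F: "intersecting n k t F" by (simp add: optimal_def)
  let ?G = "shift F x y ` F"
  note sh = intersecting_shift[OF F xy]
  have "card ?G = card F" using sh(2) by (rule card_image)
  then have "optimal n k t ?G" using opt sh(1) unfolding optimal_def by simp
  then have "potential n q F \<le> potential n q ?G" using assms unfolding extremal_def by blast
  also have "potential n q ?G = (\<Sum>A\<in>F. weight n q (shift F x y A))"
    unfolding potential_def using sh(2) by (simp add: sum.reindex)
  also have "\<dots> < (\<Sum>A\<in>F. weight n q A)"
  proof (rule sum_strict_mono_ex1)
    show "finite F" using intersecting_finite[OF F] .
    have sub: "B \<subseteq> {1..n}" if "B \<in> F" for B using that F k_setsD[of B n k] unfolding intersecting_def by blast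
    have "weight n q (shift F x y B) \<le> weight n q B" if "B \<in> F" for B
      using weight_exchange[OF sub[OF that] xy(2), of q] unfolding shift_def by auto
    then show "\<forall>B\<in>F. weight n q (shift F x y B) \<le> weight n q B" by blast
    show "\<exists>B\<in>F. weight n q (shift F x y B) < weight n q B"
      using weight_exchange[OF sub[OF A(1)] xy(2), of q] A unfolding shift_def by auto
  qed
  finally show False unfolding potential_def by simp
qed

section \<open>Breaking ties between optimal families\<close>

lemma weight_less:
  assumes "A \<subseteq> {1..n}" "card (A \<inter> {q+1..n}) < card (B \<inter> {q+1..n})"
  shows "weight n q A < weight n q B"
proof -
  have "card A \<le> n" using card_mono[of "{1..n}" A] assms(1) by simp
  then have "card A * n \<le> n * n" by simp
  moreover have "\<Sum>A \<le> card A * n"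
    using sum_bounded_above[of A "\<lambda>x. x" n] assms(1) by (metis atLeastAtMost_iff of_nat_id subsetD)
  ultimately have "\<Sum>A \<le> n * n" by linarith
  moreover have "(n * n + 1) * (card (A \<inter> {q+1..n}) + 1) \<le> (n * n + 1) * card (B \<inter> {q+1..n})"
    using assms(2) by (intro mult_le_mono2) simp
  ultimately show ?thesis unfolding weight_def by (simp add: algebra_simps)
qed

text \<open>For m = l + 2, a removed set has its whole tail beyond \<open>m\<close>, whereas an
  added set loses the point \<open>m\<close> from the count. Equally many sets are added and
  removed, so the potential drops.\<close>

lemma (in symmetric_prefix) pulled_potential:
  assumes i: "i + i = l + t" and ne: "tails i \<noteq> {}" and m: "m = l + 2"
    and eq: "(l choose (i - 1)) * card (tails_with i m) = (l choose i) * card (tails_without i m)"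
  shows "optimal n k t (pulled i m)" "potential n m (pulled i m) < potential n m F"
proof -
  have cardG: "card (pulled i m) = card F" using pulled(2)[OF i, of m] eq by simp
  then show "optimal n k t (pulled i m)" using pulled(1)[OF i, of m] opt unfolding optimal_def by simp
  let ?R = "block i (tails_without i m)" and ?A = "pushed_block i (tails_with i m)"
  have sub: "tails_with i m \<subseteq> tails i" "tails_without i m \<subseteq> tails i" by auto
  have RF: "?R \<subseteq> F" by (rule block_subset[OF sub(2)])
  have AF: "?A \<inter> F = {}" by (rule pushed_block_disjoint[OF sub(1)])
  have finR: "finite ?R" using RF finite_F finite_subset by blast
  have finA: "finite ?A" by (rule finite_subset[OF pushed_block_k_sets[OF sub(1)] finite_k_sets])
  have cards: "card ?A = card ?R" using card_block[OF sub(2)] card_pushed_block[OF sub(1)] eq by simp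
  have il: "1 \<le> i" "i \<le> l" using ne tailsD(2,3) by blast+
  have "?A \<noteq> {}"
  proof
    assume "?A = {}"
    then have "card ?A = 0" "card ?R = 0" using cards by simp_all
    then have "card (tails_with i m) = 0" "card (tails_without i m) = 0"
      using card_block[OF sub(2)] card_pushed_block[OF sub(1)] il by auto
    then have "tails_with i m = {}" "tails_without i m = {}" using finite_tails by (simp_all add: card_eq_0_iff)
    then show False using ne by blast
  qed
  have wt: "weight n m A < weight n m B" if "A \<in> ?A" "B \<in> ?R" for A B
  proof (rule weight_less)
    show "A \<subseteq> {1..n}" using pushed_block_k_sets[OF sub(1)] that(1) k_setsD[of A n k] by blast
    obtain X T where A: "A = insert (l+1) (X \<union> T)" "X \<subseteq> {1..l}" "T \<in> tails i" "m \<in> T"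
      using \<open>A \<in> ?A\<close> unfolding pushed_block_def by auto
    obtain Y S where B: "B = Y \<union> S" "Y \<subseteq> {1..l}" "S \<in> tails i" "m \<notin> S"
      using \<open>B \<in> ?R\<close> unfolding block_def by auto
    have "A \<inter> {m+1..n} \<subseteq> T - {m}" using A(1,2) m by auto
    then have "card (A \<inter> {m+1..n}) \<le> card (T - {m})" using tailsD(4)[OF A(3)] by (intro card_mono) auto
    also have "\<dots> < card T" using tailsD(4)[OF A(3)] A(4) by (rule card_Diff1_less)
    also have "card T = card S" using card_tail[OF A(3)] card_tail[OF B(3)] by simp
    also have "\<dots> \<le> card (B \<inter> {m+1..n})"
    proof (rule card_mono)
      show "S \<subseteq> B \<inter> {m+1..n}"
      proof
        fix x assume "x \<in> S"
        moreover then have "x \<noteq> m" "x \<in> {l+2..n}" using B(4) tailsD(1)[OF B(3)] by blast+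
        ultimately show "x \<in> B \<inter> {m+1..n}" using B(1) m by auto
      qed
    qed simp
    finally show "card (A \<inter> {m+1..n}) < card (B \<inter> {m+1..n})" .
  qed
  \<comment> \<open>Every added set is lighter than every removed one, so any bijection compares the
    sums.\<close>
  obtain h where h: "bij_betw h ?A ?R" using finite_same_card_bij[OF finA finR cards] by blast
  have "(\<Sum>A\<in>?A. weight n m A) < (\<Sum>A\<in>?A. weight n m (h A))"
    using finA \<open>?A \<noteq> {}\<close> wt h by (intro sum_strict_mono) (auto simp: bij_betw_def)
  also have "\<dots> = (\<Sum>B\<in>?R. weight n m B)" using h by (rule sum.reindex_bij_betw)
  finally have less: "(\<Sum>A\<in>?A. weight n m A) < (\<Sum>B\<in>?R. weight n m B)" .
  have "potential n m (pulled i m) = (\<Sum>A\<in>F - ?R. weight n m A) + (\<Sum>A\<in>?A. weight n m A)"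
    unfolding pulled_def potential_def using finite_F finA AF by (intro sum.union_disjoint) auto
  moreover have "potential n m F = (\<Sum>A\<in>F - ?R. weight n m A) + (\<Sum>A\<in>?R. weight n m A)"
    unfolding potential_def by (rule sum.subset_diff[OF RF finite_F])
  ultimately show "potential n m (pulled i m) < potential n m F" using less by simp
qed

text \<open>\<open>cond\<close> denies the diagonal inequality for all q <= r, except for a tie at q
  = r, which minimal potential excludes.\<close>

lemma symmetric_upto:
  assumes opt: "optimal n k t F" and left: "left_compressed n F" and t: "2 \<le> t" and r: "t + 2 * r \<le> n"
    and cond: "\<And>q. 1 \<le> q \<Longrightarrow> q \<le> r \<Longrightarrow>
      int q * (int n + 2 * int t - 2 * int k - 2) < (int t - 1) * (int k - int t + 1) \<or>
      q = r \<and> int q * (int n + 2 * int t - 2 * int k - 2) = (int t - 1) * (int k - int t + 1) \<and>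
        extremal n k t (t + 2 * r) F"
  shows "symmetric_on {1..t + 2 * r} F"
proof -
  have "symmetric_on {1..l} F" if "l \<le> t + 2 * r" for l
    using that
  proof (induction l)
    case 0
    show ?case by (simp add: symmetric_on_def)
  next
    case (Suc l)
    interpret symmetric_prefix n k t l F
      by unfold_locales (use opt left t r Suc in simp_all)
    have "tails i = {}" for i
    proof (rule ccontr)
      assume ne: "tails i \<noteq> {}"
      then have i: "i + i = l + t" using tails_off_diagonal[OF t] by blast
      have il: "i \<le> l" using ne tailsD(3) by blast
      define q where "q = i - t + 1"
      \<comment> \<open>From 2i = l + t follows 2q = l - t + 2, and l < t + 2r.\<close>
      have q: "1 \<le> q" "q \<le> r" using i il Suc.prems unfolding q_def by auto
      note diag = diagonal_inequality[OF i ne, folded q_def]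
      from cond[OF q] diag(1) have qr: "q = r"
        and e: "int q * (int n + 2 * int t - 2 * int k - 2) = (int t - 1) * (int k - int t + 1)"
        and ext: "extremal n k t (t + 2 * r) F" by linarith+
      \<comment> \<open>In a tie the point l + 2 is exactly the threshold of the potential minimised
        by \<open>F\<close>.\<close>
      have m: "t + 2 * r = l + 2" using qr i il unfolding q_def by linarith
      have "l + 2 \<in> {l+2..n}" using m r by simp
      note pp = pulled_potential[OF i ne refl diag(2)[OF e this]]
      show False using pp ext unfolding extremal_def m by (meson not_le)
    qed
    then show ?case using symmetric_step by simp
  qed
  then show ?thesis by blast
qed

section \<open>The complete intersection theorem\<close>

text \<open>Complementation alone would turn left-compressed families into right-compressed ones;
  the reversal x -> n + 1 - x corrects this.\<close>

definition rev_compl :: "nat \<Rightarrow> nat set \<Rightarrow> nat set" where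
  "rev_compl n A = {x \<in> {1..n}. n + 1 - x \<notin> A}"

lemma rev_compl_subset: "rev_compl n A \<subseteq> {1..n}"
  by (auto simp: rev_compl_def)

lemma rev_compl_invol:
  assumes "A \<subseteq> {1..n}" shows "rev_compl n (rev_compl n A) = A"
proof -
  have "x \<in> A \<longleftrightarrow> x \<in> rev_compl n (rev_compl n A)" if "x \<in> {1..n}" for x
    using that by (auto simp: rev_compl_def)
  then show ?thesis using assms rev_compl_subset[of n "rev_compl n A"] by blast
qed

lemma rev_compl_image: "rev_compl n A = (\<lambda>x. n + 1 - x) ` ({1..n} - A)"
proof (intro equalityI subsetI)
  fix x assume "x \<in> rev_compl n A"
  then have "n + 1 - x \<in> {1..n} - A" "x = n + 1 - (n + 1 - x)" by (auto simp: rev_compl_def)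
  then show "x \<in> (\<lambda>x. n + 1 - x) ` ({1..n} - A)" by blast
qed (auto simp: rev_compl_def)

lemma card_rev_compl: "A \<subseteq> {1..n} \<Longrightarrow> card (rev_compl n A) = n - card A"
proof -
  assume A: "A \<subseteq> {1..n}"
  have "inj_on (\<lambda>x. n + 1 - x) ({1..n} - A)" by (auto simp: inj_on_def)
  then have "card (rev_compl n A) = card ({1..n} - A)" unfolding rev_compl_image by (rule card_image)
  then show ?thesis using A by (simp add: card_Diff_subset finite_subset)
qed

lemma rev_compl_Int: "rev_compl n A \<inter> rev_compl n B = rev_compl n (A \<union> B)"
  by (auto simp: rev_compl_def)

lemma rev_compl_exchange:
  assumes "x \<in> {1..n}" "y \<in> {1..n}" "x \<noteq> y"
  shows "rev_compl n (insert (n + 1 - y) (A - {n + 1 - x})) = insert x (rev_compl n A - {y})"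
proof -
  have "n + 1 - z = n + 1 - y \<longleftrightarrow> z = y" "n + 1 - z = n + 1 - x \<longleftrightarrow> z = x" if "z \<in> {1..n}" for z
    using that assms by auto
  then show ?thesis using assms unfolding rev_compl_def by auto
qed

lemma exchange_closed_rev_compl:
  assumes "x \<in> {1..n}" "y \<in> {1..n}" "exchange_closed F (n + 1 - y) (n + 1 - x)"
  shows "exchange_closed (rev_compl n ` F) x y"
  unfolding exchange_closed_def
proof (intro ballI impI)
  fix B assume B: "B \<in> rev_compl n ` F" "y \<in> B" "x \<notin> B"
  then obtain A where A: "A \<in> F" "B = rev_compl n A" by blast
  have "n + 1 - y \<notin> A" "n + 1 - x \<in> A" using A B assms(1,2) by (auto simp: rev_compl_def)
  then have "insert (n + 1 - y) (A - {n + 1 - x}) \<in> F" using assms(3) A(1) exchange_closedD by blast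
  moreover have "x \<noteq> y" using B by blast
  ultimately show "insert x (B - {y}) \<in> rev_compl n ` F"
    using rev_compl_exchange[OF assms(1,2), of A] A(2) by (metis image_eqI)
qed

lemma left_compressed_rev_compl:
  assumes "left_compressed n F" shows "left_compressed n (rev_compl n ` F)"
  unfolding left_compressed_def
proof (intro allI impI)
  fix x y assume xy: "1 \<le> x" "x < y" "y \<le> n"
  then have "exchange_closed F (n + 1 - y) (n + 1 - x)"
    using assms unfolding left_compressed_def by auto
  then show "exchange_closed (rev_compl n ` F) x y" using xy by (intro exchange_closed_rev_compl) auto
qed

lemma intersecting_rev_compl:
  assumes F: "intersecting n k t F" and kt: "k \<le> n" "2 * k \<le> n + t"
  shows "intersecting n (n - k) (n + t - 2 * k) (rev_compl n ` F)" "inj_on (rev_compl n) F"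
proof -
  have mem: "A \<subseteq> {1..n} \<and> card A = k \<and> finite A" if "A \<in> F" for A
    using F k_setsD[of A n k] that unfolding intersecting_def by blast
  have "n + t - 2 * k \<le> card (rev_compl n A \<inter> rev_compl n B)" if "A \<in> F" "B \<in> F" for A B
  proof -
    have "card (A \<union> B) + card (A \<inter> B) = 2 * k"
      using card_Un_Int[of A B] mem[OF that(1)] mem[OF that(2)] by simp
    moreover have "t \<le> card (A \<inter> B)" using F that unfolding intersecting_def by blast
    moreover have "A \<union> B \<subseteq> {1..n}" using mem[OF that(1)] mem[OF that(2)] by blast
    ultimately show ?thesis unfolding rev_compl_Int by (simp add: card_rev_compl)
  qed
  moreover have "rev_compl n A \<in> k_sets n (n - k)" if "A \<in> F" for A
    using mem[OF that] rev_compl_subset[of n A] card_rev_compl[of A n] by (simp add: k_sets_def)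
  ultimately show "intersecting n (n - k) (n + t - 2 * k) (rev_compl n ` F)"
    unfolding intersecting_def by blast
  have inv: "rev_compl n (rev_compl n A) = A" if "A \<in> F" for A using rev_compl_invol[of A n] mem[OF that] by blast
  then show "inj_on (rev_compl n) F" by (metis inj_onI)
qed

lemma optimal_rev_compl:
  assumes F: "optimal n k t F" and kt: "k \<le> n" "2 * k \<le> n + t"
  shows "optimal n (n - k) (n + t - 2 * k) (rev_compl n ` F)"
proof -
  have int: "intersecting n k t F" using F by (simp add: optimal_def)
  note rc = intersecting_rev_compl[OF int kt]
  have "card G \<le> card (rev_compl n ` F)" if G: "intersecting n (n - k) (n + t - 2 * k) G" for G
  proof -
    \<comment> \<open>The change of parameters is an involution, so competitors can be carried back
      to the original problem.\<close>
    have e: "n - (n - k) = k" "n + (n + t - 2 * k) - 2 * (n - k) = t" "n - k \<le> n" "2 * (n - k) \<le> n + (n + t - 2 * k)"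
      using kt by linarith+
    note rG = intersecting_rev_compl[OF G e(3,4), unfolded e]
    have "card G = card (rev_compl n ` G)" using card_image[OF rG(2)] by simp
    also have "\<dots> \<le> card F" using F rG(1) unfolding optimal_def by blast
    also have "\<dots> = card (rev_compl n ` F)" using card_image[OF rc(2)] by simp
    finally show ?thesis .
  qed
  then show ?thesis using rc(1) unfolding optimal_def by blast
qed

lemma symmetric_on_rev_compl:
  assumes "F \<subseteq> k_sets n k" and "symmetric_on {1..n - s} (rev_compl n ` F)"
  shows "symmetric_on {s+1..n} F"
proof -
  have inv: "rev_compl n (rev_compl n A) = A" if "A \<in> F" for A
    using rev_compl_invol[of A n] assms(1) that k_setsD[of A n k] by blast
  have eq: "rev_compl n ` rev_compl n ` F = F" using inv by (force simp: image_image)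
  have "exchange_closed F x y" if "x \<in> {s+1..n}" "y \<in> {s+1..n}" for x y
  proof -
    have "n + 1 - x \<in> {1..n - s}" "n + 1 - y \<in> {1..n - s}" using that by auto
    then have "exchange_closed (rev_compl n ` F) (n + 1 - y) (n + 1 - x)"
      using assms(2) unfolding symmetric_on_def by blast
    then have "exchange_closed (rev_compl n ` rev_compl n ` F) x y"
      by (rule exchange_closed_rev_compl[rotated 2]) (use that in auto)
    then show ?thesis unfolding eq .
  qed
  then show ?thesis unfolding symmetric_on_def by blast
qed

text \<open>With both symmetries and compression, membership of \<open>A\<close> forces that of
  every \<open>k\<close>-set with at least as many points in {1..s}. If \<open>A\<close> had too few
  there, one of these sets would meet \<open>A\<close> in fewer than \<open>t\<close>
  points.\<close>

lemma subset_frankl_family: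
  assumes F: "intersecting n k t F" and left: "left_compressed n F"
    and sym: "symmetric_on {1..s} F" "symmetric_on {s+1..n} F"
    and s: "s = t + 2 * r" "s \<le> n" and kt: "t + r \<le> k" "2 * k < n + t" "1 \<le> t"
  shows "F \<subseteq> frankl_family n k t r"
proof
  fix A assume AF: "A \<in> F"
  have A: "A \<subseteq> {1..n}" "card A = k" "finite A"
    using F k_setsD[of A n k] AF unfolding intersecting_def by blast+
  let ?P = "{1..s}" and ?Q = "{s+1..n}"
  have PQ: "?P \<union> ?Q = {1..n}" "?P \<inter> ?Q = {}" using s(2) by auto
  define i where "i = card (A \<inter> ?P)"
  have Asplit: "A = (A \<inter> ?P) \<union> (A \<inter> ?Q)" using A(1) PQ by blast
  have cA: "card A = card (A \<inter> ?P) + card (A \<inter> ?Q)"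
    by (subst Asplit, rule card_Un_disjoint) (use A(3) PQ in auto)
  then have cQ: "card (A \<inter> ?Q) = k - i" "i \<le> k" using A(2) unfolding i_def by linarith+
  have cQ': "k - i \<le> n - s" using card_mono[of ?Q "A \<inter> ?Q"] cQ by simp
  have i_s: "i \<le> s" using card_mono[of ?P "A \<inter> ?P"] unfolding i_def by simp
  have "t + r \<le> i"
  proof (rule ccontr)
    assume "\<not> t + r \<le> i"
    then have i: "i < t + r" by simp
    \<comment> \<open>The value 2t + 2r - 1 - i makes the forced overlap in the first part equal to
      t - 1; then 2k < n + t forces none in the second. The caps \<open>k\<close> and
      \<open>s\<close> keep the size feasible.\<close>
    define j where "j = min (min k s) (2 * t + 2 * r - 1 - i)"
    have j: "i \<le> j" "j \<le> k" "j \<le> s" "k - j \<le> n - s"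
      using i cQ i_s s kt unfolding j_def by auto
    have small: "(i + j - s) + ((k - i) + (k - j) - (n - s)) < t"
      using i cQ cQ' i_s s kt unfolding j_def min_def by (auto split: if_splits)
    obtain Y where Y: "Y \<subseteq> ?P" "card Y = j" "card (A \<inter> ?P \<inter> Y) = i + j - s"
      using ex_min_intersection[of ?P "A \<inter> ?P" j] j unfolding i_def by auto
    obtain Z where Z: "Z \<subseteq> ?Q" "card Z = k - j" "card (A \<inter> ?Q \<inter> Z) = (k - i) + (k - j) - (n - s)"
      using ex_min_intersection[of ?Q "A \<inter> ?Q" "k - j"] j(4) unfolding cQ by auto
    have fin: "finite Y" "finite Z" using Y(1) Z(1) finite_subset by blast+
    have disj: "Y \<inter> Z = {}" using Y(1) Z(1) PQ(2) by blast
    have "Y \<union> Z \<in> F"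
    proof (rule threshold_mem[OF AF A(3), where S = ?P and N = "{1..n}"])
      show "finite (Y \<union> Z)" using fin by simp
      show "card A = card (Y \<union> Z)" using card_Un_disjoint[OF fin disj] Y Z A j by simp
      have "(Y \<union> Z) \<inter> ?P = Y" using Y(1) Z(1) PQ(2) by blast
      then show "card (A \<inter> ?P) \<le> card ((Y \<union> Z) \<inter> ?P)" using Y j unfolding i_def by simp
      show "A \<union> (Y \<union> Z) \<subseteq> {1..n}" using A(1) Y(1) Z(1) PQ(1) by blast
      fix x y assume xy: "x \<in> {1..n}" "y \<in> {1..n}" "x \<in> ?P \<or> y \<notin> ?P"
      then consider "x \<in> ?P" "y \<in> ?P" | "x \<in> ?Q" "y \<in> ?Q" | "x \<in> ?P" "y \<in> ?Q" using PQ by blast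
      then show "exchange_closed F x y"
      proof cases
        case 3
        then show ?thesis using left unfolding left_compressed_def by auto
      qed (use sym in \<open>auto simp: symmetric_on_def\<close>)
    qed
    then have "t \<le> card (A \<inter> (Y \<union> Z))" using F AF unfolding intersecting_def by blast
    also have "A \<inter> (Y \<union> Z) = (A \<inter> ?P \<inter> Y) \<union> (A \<inter> ?Q \<inter> Z)" using Y(1) Z(1) by blast
    also have "card \<dots> \<le> card (A \<inter> ?P \<inter> Y) + card (A \<inter> ?Q \<inter> Z)" by (rule card_Un_le)
    also have "\<dots> < t" unfolding Y(3) Z(3) by (rule small)
    finally show False by simp
  qed
  then show "A \<in> frankl_family n k t r" using A s unfolding frankl_family_def i_def by simp
qed

section \<open>Optimality of the Frankl families\<close>

lemma frankl_family_subset: "frankl_family n k t r \<subseteq> k_sets n k"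
  by (auto simp: frankl_family_def k_sets_def)

lemma intersecting_frankl_family: "intersecting n k t (frankl_family n k t r)"
  unfolding intersecting_def
proof (intro conjI ballI)
  show "frankl_family n k t r \<subseteq> k_sets n k" by (rule frankl_family_subset)
  fix A B assume AB: "A \<in> frankl_family n k t r" "B \<in> frankl_family n k t r"
  let ?P = "{1..t + 2 * r}"
  have c: "t + r \<le> card (A \<inter> ?P)" "t + r \<le> card (B \<inter> ?P)" using AB by (auto simp: frankl_family_def)
  have fin: "finite A" using AB finite_subset by (auto simp: frankl_family_def)
  have "card (A \<inter> ?P) + card (B \<inter> ?P) - card ?P \<le> card ((A \<inter> ?P) \<inter> (B \<inter> ?P))"
    by (rule card_inter_ge) auto
  also have "\<dots> \<le> card (A \<inter> B)" using fin by (intro card_mono) auto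
  finally show "t \<le> card (A \<inter> B)" using c by simp
qed

text \<open>Apart from the boundary cases, \<open>L\<close> and \<open>R\<close> place (t - 1)(k - t
  + 1) between consecutive multiples of n + 2t - 2k - 2, namely the \<open>r\<close>-th and the
  next. \<open>L\<close> gives symmetry on the left, \<open>R\<close> on the right through
  \<open>rev_compl\<close>; in the boundary cases the part in question is a single point. Only
  \<open>L\<close> admits a tie, so \<open>F\<close> is taken extremal for the threshold
  \<open>s\<close>.\<close>

lemma intersecting_card_le_frankl:
  assumes G: "intersecting n k t G" and kt: "1 \<le> t" "t + r \<le> k" "k \<le> n" "2 * k < n + t"
    and L: "t = 1 \<and> r = 0 \<or>
      2 \<le> t \<and> int r * (int n + 2 * int t - 2 * int k - 2) \<le> (int t - 1) * (int k - int t + 1)"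
    and R: "n + t = 2 * k + 1 \<and> r = k - t \<or>
      2 * k + 2 \<le> n + t \<and> (int t - 1) * (int k - int t + 1) < (int r + 1) * (int n + 2 * int t - 2 * int k - 2)"
  shows "card G \<le> card (frankl_family n k t r)"
proof -
  define s where "s = t + 2 * r"
  have sn: "s \<le> n" using kt unfolding s_def by linarith
  obtain F where ext: "extremal n k t s F" using ex_extremal by blast
  then have opt: "optimal n k t F" by (simp add: extremal_def)
  then have int: "intersecting n k t F" by (simp add: optimal_def)
  have left: "left_compressed n F" using extremal_left_compressed[OF ext] .
  let ?D = "int n + 2 * int t - 2 * int k - 2"
  have triv: "symmetric_on {1..1} H" for H
    by (auto simp: symmetric_on_def exchange_closed_def)
  have symL: "symmetric_on {1..s} F"
  proof (cases "t = 1 \<and> r = 0")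
    case True
    then show ?thesis using triv unfolding s_def by simp
  next
    case False
    then have t2: "2 \<le> t" and le: "int r * ?D \<le> (int t - 1) * (int k - int t + 1)" using L by auto
    have D: "?D > 0" using kt t2 by linarith
    show ?thesis
      unfolding s_def
    proof (rule symmetric_upto[OF opt left t2 sn[unfolded s_def]])
      fix q assume q: "1 \<le> q" "q \<le> r"
      show "int q * ?D < (int t - 1) * (int k - int t + 1) \<or>
        q = r \<and> int q * ?D = (int t - 1) * (int k - int t + 1) \<and> extremal n k t (t + 2 * r) F"
      proof (cases "q = r")
        case True
        then show ?thesis using le ext unfolding s_def by auto
      next
        case False
        then have "int q * ?D < int r * ?D" using q D by (intro mult_strict_right_mono) auto
        then show ?thesis using le by linarith
      qed
    qed
  qed
  define k' t' r' where "k' = n - k" and "t' = n + t - 2 * k" and "r' = k - t - r"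
  have ints: "int k' = int n - int k" "int t' = int n + int t - 2 * int k" "int r' = int k - int t - int r"
    using kt unfolding k'_def t'_def r'_def by auto
  have s': "t' + 2 * r' = n - s" using kt unfolding t'_def r'_def s_def by linarith
  have opt': "optimal n k' t' (rev_compl n ` F)" unfolding k'_def t'_def
    using optimal_rev_compl[OF opt] kt by simp
  have left': "left_compressed n (rev_compl n ` F)" by (rule left_compressed_rev_compl[OF left])
  have symR': "symmetric_on {1..n - s} (rev_compl n ` F)"
  proof (cases "n + t = 2 * k + 1 \<and> r = k - t")
    case True
    then have "n - s = 1" using kt unfolding s_def by linarith
    then show ?thesis using triv by simp
  next
    case False
    then have t2: "2 \<le> t'" and less: "(int t - 1) * (int k - int t + 1) < (int r + 1) * ?D"
      using R unfolding t'_def by auto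
    have D: "?D > 0" using kt t2 unfolding t'_def by linarith
    have D': "int n + 2 * int t' - 2 * int k' - 2 = ?D" unfolding ints by simp
    show ?thesis
      unfolding s'[symmetric]
    proof (rule symmetric_upto[OF opt' left' t2])
      show "t' + 2 * r' \<le> n" unfolding s' by simp
      fix q assume q: "1 \<le> q" "q \<le> r'"
      have "int q * ?D \<le> int r' * ?D" using q D by (intro mult_right_mono) auto
      \<comment> \<open>Since k' - t' = k - t and ?D = (t - 1) + (t' - 1), this is the strict
        inequality of \<open>R\<close> rearranged for r' = k - t - r.\<close>
      also have "\<dots> < (int t' - 1) * (int k' - int t' + 1)"
        using less unfolding ints by (simp add: algebra_simps)
      finally show "int q * (int n + 2 * int t' - 2 * int k' - 2) < (int t' - 1) * (int k' - int t' + 1) \<or>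
        q = r' \<and> int q * (int n + 2 * int t' - 2 * int k' - 2) = (int t' - 1) * (int k' - int t' + 1) \<and>
        extremal n k' t' (t' + 2 * r') (rev_compl n ` F)"
        unfolding D' by blast
    qed
  qed
  have "symmetric_on {s+1..n} F"
    using int symR' unfolding intersecting_def by (intro symmetric_on_rev_compl) auto
  then have "F \<subseteq> frankl_family n k t r"
    using subset_frankl_family[OF int left symL _ s_def sn] kt by blast
  then have "card F \<le> card (frankl_family n k t r)"
    using frankl_family_subset finite_k_sets by (meson card_mono finite_subset)
  moreover have "card G \<le> card F" using G opt unfolding optimal_def by blast
  ultimately show ?thesis by linarith
qed

text \<open>For n = 2k and t = 1 the factor n + 2t - 2k - 2 vanishes, so this case is treated
  directly: \<open>G\<close> contains at most one of a set and its complement, and \<open>f\<close>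
  selects the one through 1.\<close>

lemma intersecting_half_card_le_frankl:
  assumes G: "intersecting (2 * k) k 1 G" and k: "1 \<le> k"
  shows "card G \<le> card (frankl_family (2 * k) k 1 0)"
proof -
  let ?N = "{1..2 * k}"
  define f where "f A = (if 1 \<in> A then A else ?N - A)" for A
  have mem: "A \<subseteq> ?N \<and> card A = k \<and> finite A" if "A \<in> G" for A
    using G k_setsD[of A "2 * k" k] that unfolding intersecting_def by blast
  have int: "A \<inter> B \<noteq> {}" if "A \<in> G" "B \<in> G" for A B
    using G that unfolding intersecting_def by fastforce
  have f: "f A \<subseteq> ?N \<and> card (f A) = k \<and> 1 \<in> f A" if "A \<in> G" for A
    using mem[OF that] k by (auto simp: f_def card_Diff_subset)
  have "f A \<in> frankl_family (2 * k) k 1 0" if "A \<in> G" for A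
  proof -
    have "f A \<inter> {1..1 + 2 * 0} = {1}" using f[OF that] by auto
    then show ?thesis using f[OF that] unfolding frankl_family_def by simp
  qed
  moreover have "inj_on f G"
  proof (rule inj_onI)
    fix A B assume AB: "A \<in> G" "B \<in> G" "f A = f B"
    then show "A = B" using mem[OF AB(1)] mem[OF AB(2)] int[OF AB(1,2)] unfolding f_def
      by (auto split: if_splits)
  qed
  moreover have "finite (frankl_family (2 * k) k 1 0)"
    by (rule finite_subset[OF frankl_family_subset finite_k_sets])
  ultimately show ?thesis by (metis card_inj_on_le image_subsetI)
qed

text \<open>The window {1..t+2r} with the largest \<open>r\<close> misses at most one point of
  {1..n}, so every \<open>k\<close>-set meets it in enough points.\<close>

lemma frankl_family_full:
  assumes "n + t \<le> 2 * k" "k \<le> n" "t \<le> k"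
  shows "frankl_family n k t ((n - t) div 2) = k_sets n k"
proof -
  let ?r = "(n - t) div 2"
  have "A \<in> frankl_family n k t ?r" if "A \<in> k_sets n k" for A
  proof -
    have A: "A \<subseteq> {1..n}" "card A = k" "finite A" using k_setsD[OF that] by auto
    have "card A + card {1..t + 2 * ?r} - card {1..n} \<le> card (A \<inter> {1..t + 2 * ?r})"
      using assms A by (intro card_inter_ge) auto
    then have "k + (t + 2 * ?r) - n \<le> card (A \<inter> {1..t + 2 * ?r})" using A by simp
    moreover have "t + ?r \<le> k + (t + 2 * ?r) - n"
    proof -
      have "n - t = 2 * ?r \<or> n - t = 2 * ?r + 1" by presburger
      then show ?thesis using assms by linarith
    qed
    ultimately show ?thesis using A unfolding frankl_family_def by simp
  qed
  then show ?thesis using frankl_family_subset by blast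
qed

lemma finite_frankl_cards: "finite {card (frankl_family n k t r) | r. t + 2 * r \<le> n}"
proof -
  have "{card (frankl_family n k t r) | r. t + 2 * r \<le> n} = (\<lambda>r. card (frankl_family n k t r)) ` {r. t + 2 * r \<le> n}"
    by blast
  moreover have "finite {r. t + 2 * r \<le> n}" by (rule finite_subset[of _ "{..n}"]) auto
  ultimately show ?thesis by simp
qed

lemma frankl_max_ge: "t + 2 * r \<le> n \<Longrightarrow> card (frankl_family n k t r) \<le> frankl_max n k t"
  unfolding frankl_max_def using finite_frankl_cards by (intro Max_ge) auto

theorem complete_intersection:
  assumes G: "intersecting n k t G" and kt: "1 \<le> t" "t \<le> k" "k \<le> n"
  shows "card G \<le> frankl_max n k t"
proof -
  have "\<exists>r. t + 2 * r \<le> n \<and> card G \<le> card (frankl_family n k t r)"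
  proof -
    consider "n + t \<le> 2 * k" | "n = 2 * k" "t = 1" | "2 \<le> t" "n + t = 2 * k + 1" | "2 * k + 2 \<le> n + t"
      using kt by linarith
    then show ?thesis
    proof cases
      case 1
      have "card G \<le> card (k_sets n k)" using G unfolding intersecting_def by (simp add: card_mono)
      then show ?thesis using frankl_family_full[OF 1 kt(3,2)] kt
        by (intro exI[of _ "(n - t) div 2"]) auto
    next
      case 2
      then show ?thesis using intersecting_half_card_le_frankl[of k G] G kt by (intro exI[of _ 0]) auto
    next
      case 3
      \<comment> \<open>The quotient would be k - t + 1, one more than t + r <= k permits; so r = k
        - t is used, with the boundary alternative of \<open>R\<close>.\<close>
      have D: "int n + 2 * int t - 2 * int k - 2 = int t - 1" using 3 by linarith
      have "card G \<le> card (frankl_family n k t (k - t))"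
      proof (rule intersecting_card_le_frankl[OF G kt(1) _ kt(3)])
        show "t = 1 \<and> k - t = 0 \<or> 2 \<le> t \<and> int (k - t) * (int n + 2 * int t - 2 * int k - 2)
            \<le> (int t - 1) * (int k - int t + 1)"
          unfolding D using 3 kt by (simp add: of_nat_diff algebra_simps)
      qed (use 3 kt in auto)
      then show ?thesis using 3 kt by (intro exI[of _ "k - t"]) auto
    next
      case 4
      define a D m where "a = t - 1" and "D = n + 2 * t - 2 * k - 2" and "m = k - t + 1"
      have ints: "int a = int t - 1" "int D = int n + 2 * int t - 2 * int k - 2" "int m = int k - int t + 1"
        using 4 kt unfolding a_def D_def m_def by auto
      have aD: "a < D" using 4 kt unfolding a_def D_def by linarith
      \<comment> \<open>The optimal parameter is this integer quotient; a < D makes it smaller than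
        \<open>m\<close>, that is, t + r <= k.\<close>
      define r where "r = a * m div D"
      have r1: "r * D \<le> a * m" unfolding r_def by simp
      have r2: "a * m < (r + 1) * D" unfolding r_def using aD by (metis Suc_eq_plus1 dividend_less_div_times mult.commute mult_Suc not_less0 not_gr_zero)
      have "r * D < m * D"
      proof (rule le_less_trans[OF r1])
        show "a * m < m * D" unfolding mult.commute[of m D]
          by (rule mult_less_mono1[OF aD]) (simp add: m_def)
      qed
      then have "r < m" by simp
      then have rk: "t + r \<le> k" using kt unfolding m_def by linarith
      have i1: "int r * int D \<le> int a * int m" using r1 by (metis of_nat_le_iff of_nat_mult)
      have i2: "int a * int m < (int r + 1) * int D" using r2 by (metis of_nat_less_iff of_nat_mult of_nat_add of_nat_1)
      have "card G \<le> card (frankl_family n k t r)"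
      proof (rule intersecting_card_le_frankl[OF G kt(1) rk kt(3)])
        show "2 * k < n + t" using 4 by simp
        show "t = 1 \<and> r = 0 \<or> 2 \<le> t \<and> int r * (int n + 2 * int t - 2 * int k - 2)
            \<le> (int t - 1) * (int k - int t + 1)"
        proof (cases "t = 1")
          case True
          then show ?thesis unfolding r_def a_def by simp
        next
          case False
          then show ?thesis using i1 kt unfolding ints by simp
        qed
        show "n + t = 2 * k + 1 \<and> r = k - t \<or> 2 * k + 2 \<le> n + t \<and>
            (int t - 1) * (int k - int t + 1) < (int r + 1) * (int n + 2 * int t - 2 * int k - 2)"
          using i2 4 unfolding ints by simp
      qed
      moreover have "t + 2 * r \<le> n" using rk 4 by linarith
      ultimately show ?thesis by blast
    qed
  qed
  then show ?thesis using frankl_max_ge order_trans by blast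
qed

section \<open>Fractional colourings\<close>

text \<open>Disjoint intervals of length \<open>b\<close> serve as colour sets; this makes the
  \<open>LEAST\<close> in the chromatic number an attained value.\<close>

lemma ex_fold_colouring:
  assumes fin: "finite (verts H)" and loopless: "\<And>v. \<not> adj H v v"
  shows "\<exists>m c. is_fold_colouring H b m c"
proof -
  obtain e :: "'a \<Rightarrow> nat" where e: "bij_betw e (verts H) {..<card (verts H)}"
    using ex_bij_betw_finite_nat[OF fin] by (auto simp: atLeast0LessThan)
  let ?m = "card (verts H) * b" and ?c = "\<lambda>v. {e v * b..<e v * b + b}"
  have "?c v \<subseteq> {..<?m}" if "v \<in> verts H" for v
  proof -
    have "e v < card (verts H)" using e that by (auto simp: bij_betw_def)
    then have "Suc (e v) * b \<le> ?m" by (intro mult_le_mono1) simp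
    then show ?thesis by auto
  qed
  moreover have "?c u \<inter> ?c v = {}" if "u \<in> verts H" "v \<in> verts H" "adj H u v" for u v
  proof -
    have "e u \<noteq> e v" using e that loopless unfolding bij_betw_def inj_on_def by metis
    then have "Suc (e u) * b \<le> e v * b \<or> Suc (e v) * b \<le> e u * b"
      by (metis Suc_leI linorder_neqE_nat mult_le_mono1)
    then show ?thesis by auto
  qed
  ultimately show ?thesis unfolding is_fold_colouring_def
    by (intro exI[of _ ?m] exI[of _ ?c]) auto
qed

text \<open>One colouring that meets the universal lower bound makes the infimum a minimum.\<close>

lemma fractional_chromatic_number_eqI:
  fixes q :: real
  assumes fin: "finite (verts H)" and loopless: "\<And>v. \<not> adj H v v"
    and lower: "\<And>b m c. 1 \<le> b \<Longrightarrow> is_fold_colouring H b m c \<Longrightarrow> q * real b \<le> real m"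
    and b: "1 \<le> b" and m: "is_fold_colouring H b m c" and eq: "real m = q * real b"
  shows "fractional_chromatic_number H = q"
proof -
  have ge: "q \<le> real (fold_chromatic_number b' H) / real b'" if "1 \<le> b'" for b'
  proof -
    have "\<exists>c. is_fold_colouring H b' (fold_chromatic_number b' H) c"
      unfolding fold_chromatic_number_def
      by (rule LeastI_ex) (rule ex_fold_colouring[OF fin loopless])
    then have "q * real b' \<le> real (fold_chromatic_number b' H)" using lower that by blast
    then show ?thesis using that by (simp add: pos_le_divide_eq)
  qed
  have "fold_chromatic_number b H \<le> m"
    unfolding fold_chromatic_number_def using m by (intro Least_le) blast
  then have "real (fold_chromatic_number b H) / real b \<le> real m / real b" by (simp add: divide_right_mono)
  also have "\<dots> = q" using eq b by simp
  finally have "real (fold_chromatic_number b H) / real b = q" using ge[OF b] by simp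
  then have "q \<in> (\<lambda>b. real (fold_chromatic_number b H) / real b) ` {1..}" using b by force
  then show ?thesis
    unfolding fractional_chromatic_number_def using ge by (intro cInf_eq_minimum) auto
qed

section \<open>Counting permutations that map into a family\<close>

lemma ex_permutation_image:
  assumes "finite N" "A \<subseteq> N" "B \<subseteq> N" "card A = card B"
  shows "\<exists>\<sigma>. \<sigma> permutes N \<and> \<sigma> ` A = B"
proof -
  have fin: "finite A" "finite B" using assms finite_subset by blast+
  obtain f where f: "bij_betw f A B" using finite_same_card_bij[OF fin assms(4)] by blast
  have "card (N - A) = card (N - B)" using assms fin by (simp add: card_Diff_subset)
  then obtain g where g: "bij_betw g (N - A) (N - B)" using finite_same_card_bij assms(1) by (metis finite_Diff)
  define \<sigma> where "\<sigma> x = (if x \<in> A then f x else if x \<in> N then g x else x)" for x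
  have "bij_betw \<sigma> A B" using f by (rule bij_betw_cong[THEN iffD1, rotated]) (simp add: \<sigma>_def)
  moreover have "bij_betw \<sigma> (N - A) (N - B)"
    using g by (rule bij_betw_cong[THEN iffD1, rotated]) (simp add: \<sigma>_def)
  ultimately have "bij_betw \<sigma> (A \<union> (N - A)) (B \<union> (N - B))" by (rule bij_betw_combine) blast
  then have "bij_betw \<sigma> N N" using assms(2,3) by (simp add: Un_absorb1)
  then have "\<sigma> permutes N" by (rule bij_imp_permutes) (use assms(2) in \<open>auto simp: \<sigma>_def\<close>)
  then show ?thesis using \<open>bij_betw \<sigma> A B\<close> by (auto simp: bij_betw_def)
qed

text \<open>Pairs of a permutation and a \<open>k\<close>-set mapped into \<open>F\<close> are
  counted twice. Each permutation contributes \<open>card F\<close> sets; the count per set is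
  constant because composition with a permutation taking \<open>B\<close> to \<open>A\<close>
  matches the two counts.\<close>

lemma card_permutations_into:
  assumes FK: "F \<subseteq> k_sets n k" and A: "A \<in> k_sets n k"
  shows "(n choose k) * card {\<pi>. \<pi> permutes {1..n} \<and> \<pi> ` A \<in> F} = fact n * card F"
proof -
  let ?P = "{\<pi>. \<pi> permutes {1..n}}" and ?V = "k_sets n k"
  have finP: "finite ?P" by (simp add: finite_permutations)
  have const: "card {\<pi> \<in> ?P. \<pi> ` B \<in> F} = card {\<pi> \<in> ?P. \<pi> ` A \<in> F}" if B: "B \<in> ?V" for B
  proof -
    obtain \<sigma> where \<sigma>: "\<sigma> permutes {1..n}" "\<sigma> ` B = A"
      using ex_permutation_image[of "{1..n}" B A] k_setsD[OF A] k_setsD[OF B] by auto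
    have "bij_betw (\<lambda>\<pi>. \<pi> \<circ> \<sigma>) {\<pi> \<in> ?P. \<pi> ` A \<in> F} {\<pi> \<in> ?P. \<pi> ` B \<in> F}"
    proof (rule bij_betwI[where g = "\<lambda>\<pi>. \<pi> \<circ> Hilbert_Choice.inv \<sigma>"])
      have inv: "Hilbert_Choice.inv \<sigma> permutes {1..n}" "Hilbert_Choice.inv \<sigma> ` A = B"
        using \<sigma> permutes_inv permutes_inj[OF \<sigma>(1)] by (auto simp: image_comp)
      show "(\<lambda>\<pi>. \<pi> \<circ> \<sigma>) \<in> {\<pi> \<in> ?P. \<pi> ` A \<in> F} \<rightarrow> {\<pi> \<in> ?P. \<pi> ` B \<in> F}"
        using \<sigma> by (auto simp: image_image o_def intro: permutes_compose[unfolded o_def])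
      show "(\<lambda>\<pi>. \<pi> \<circ> Hilbert_Choice.inv \<sigma>) \<in> {\<pi> \<in> ?P. \<pi> ` B \<in> F} \<rightarrow> {\<pi> \<in> ?P. \<pi> ` A \<in> F}"
        using inv by (auto simp: image_image o_def intro: permutes_compose[unfolded o_def])
      show "(\<pi> \<circ> \<sigma>) \<circ> Hilbert_Choice.inv \<sigma> = \<pi>" "(\<pi> \<circ> Hilbert_Choice.inv \<sigma>) \<circ> \<sigma> = \<pi>" for \<pi> :: "nat \<Rightarrow> nat"
        using permutes_inv_o[OF \<sigma>(1)] by (metis o_assoc comp_id)+
    qed
    from bij_betw_same_card[OF this] show ?thesis by simp
  qed
  have "card {B \<in> ?V. \<pi> ` B \<in> F} = card F" if \<pi>: "\<pi> permutes {1..n}" for \<pi>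
  proof -
    have "bij_betw (\<lambda>B. \<pi> ` B) {B \<in> ?V. \<pi> ` B \<in> F} F"
      unfolding bij_betw_def
    proof
      show "inj_on ((`) \<pi>) {B \<in> ?V. \<pi> ` B \<in> F}"
        using permutes_inj[OF \<pi>] by (simp add: inj_on_def inj_image_eq_iff)
      have "\<exists>B\<in>{B \<in> ?V. \<pi> ` B \<in> F}. C = \<pi> ` B" if "C \<in> F" for C
      proof -
        let ?B = "Hilbert_Choice.inv \<pi> ` C"
        have C: "C \<subseteq> {1..n}" "card C = k" using FK that k_setsD[of C n k] by blast+
        have im: "\<pi> ` ?B = C" using permutes_surj[OF \<pi>] by (simp add: image_f_inv_f)
        have "?B \<subseteq> {1..n}" using C(1) permutes_image[OF permutes_inv[OF \<pi>]] by blast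
        moreover have "card ?B = k"
          using card_image[of "Hilbert_Choice.inv \<pi>" C] permutes_inj[OF permutes_inv[OF \<pi>]] C(2)
          by (simp add: inj_on_subset)
        ultimately show ?thesis using im that by (intro bexI[of _ ?B]) (auto simp: k_sets_def)
      qed
      then show "(`) \<pi> ` {B \<in> ?V. \<pi> ` B \<in> F} = F" by blast
    qed
    then show ?thesis by (rule bij_betw_same_card)
  qed
  then have "(\<Sum>B\<in>?V. card {\<pi> \<in> ?P. \<pi> ` B \<in> F}) = card F * card ?P"
    using finP by (intro sum_multicount) auto
  also have "(\<Sum>B\<in>?V. card {\<pi> \<in> ?P. \<pi> ` B \<in> F}) = (n choose k) * card {\<pi> \<in> ?P. \<pi> ` A \<in> F}"
    using const by (simp add: card_k_sets)
  also have "card ?P = fact n" by (rule card_permutations) auto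
  finally show ?thesis by (simp add: mult.commute)
qed

lemma frankl_max_attained:
  assumes "t \<le> n" shows "\<exists>r. frankl_max n k t = card (frankl_family n k t r)"
proof -
  have "{card (frankl_family n k t r) | r. t + 2 * r \<le> n} \<noteq> {}" using assms by (auto intro: exI[of _ 0])
  then have "frankl_max n k t \<in> {card (frankl_family n k t r) | r. t + 2 * r \<le> n}"
    unfolding frankl_max_def using finite_frankl_cards by (intro Max_in)
  then show ?thesis by blast
qed

lemma frankl_max_pos:
  assumes "t \<le> k" "k \<le> n" shows "0 < frankl_max n k t"
proof -
  have "{1..k} \<inter> {1..t + 2 * 0} = {1..t}" using assms by auto
  then have "{1..k} \<in> frankl_family n k t 0" using assms by (simp add: frankl_family_def)
  then have "0 < card (frankl_family n k t 0)"
    using finite_subset[OF frankl_family_subset finite_k_sets] by (auto simp: card_gt_0_iff)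
  then show ?thesis using frankl_max_ge[of t 0 n k] assms by simp
qed

section \<open>Colourings of the complement graph\<close>

lemma is_fold_colouring_complement_K_ge:
  "is_fold_colouring (complement_graph (K_ge n k t)) b m c \<longleftrightarrow>
     (\<forall>A\<in>k_sets n k. c A \<subseteq> {..<m} \<and> card (c A) = b) \<and>
     (\<forall>A\<in>k_sets n k. \<forall>B\<in>k_sets n k. A \<noteq> B \<longrightarrow> card (A \<inter> B) < t \<longrightarrow> c A \<inter> c B = {})"
proof -
  have v: "verts (complement_graph (K_ge n k t)) = k_sets n k"
    by (simp add: complement_graph_def K_ge_def k_sets_def)
  have a: "adj (complement_graph (K_ge n k t)) A B \<longleftrightarrow>
      A \<in> k_sets n k \<and> B \<in> k_sets n k \<and> A \<noteq> B \<and> card (A \<inter> B) < t" for A B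
    by (simp add: complement_graph_def K_ge_def k_sets_def not_le) fast
  show ?thesis unfolding is_fold_colouring_def v a by fast
qed

text \<open>Each colour class is an intersecting family, hence bounded by
  \<open>complete_intersection\<close>; double counting incidences of sets and colours does the
  rest.\<close>

lemma fold_colouring_lower_bound:
  assumes kt: "1 \<le> t" "t \<le> k" "k \<le> n"
    and c: "is_fold_colouring (complement_graph (K_ge n k t)) b m c"
  shows "b * (n choose k) \<le> m * frankl_max n k t"
proof -
  let ?V = "k_sets n k"
  have col: "c A \<subseteq> {..<m}" "card (c A) = b" if "A \<in> ?V" for A
    using c that unfolding is_fold_colouring_complement_K_ge by blast+
  have meet: "t \<le> card (A \<inter> B)" if "A \<in> ?V" "B \<in> ?V" "c A \<inter> c B \<noteq> {}" for A B
  proof (cases "A = B")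
    case True
    then show ?thesis using that kt by (simp add: k_sets_def)
  next
    case False
    then show ?thesis using c that unfolding is_fold_colouring_complement_K_ge by (meson not_le)
  qed
  have cls: "card {A \<in> ?V. x \<in> c A} \<le> frankl_max n k t" for x
    by (rule complete_intersection[OF _ kt]) (use meet in \<open>auto simp: intersecting_def\<close>)
  have "b * card ?V = (\<Sum>x<m. card {A \<in> ?V. x \<in> c A})"
  proof (rule sum_multicount[symmetric])
    show "\<forall>A\<in>?V. card {x \<in> {..<m}. x \<in> c A} = b"
    proof
      fix A assume A: "A \<in> ?V"
      have "{x \<in> {..<m}. x \<in> c A} = c A" using col(1)[OF A] by blast
      then show "card {x \<in> {..<m}. x \<in> c A} = b" using col(2)[OF A] by simp
    qed
  qed auto
  also have "\<dots> \<le> m * frankl_max n k t" using sum_bounded_above[of "{..<m}", OF cls] by simp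
  finally show ?thesis by (simp add: card_k_sets)
qed

text \<open>A permutation colouring both \<open>A\<close> and \<open>B\<close> sends them to members
  of \<open>F\<close>, which share \<open>t\<close> elements, and permutations preserve the size of
  the intersection.\<close>

lemma permutation_fold_colouring:
  assumes F: "intersecting n k t F"
    and b: "\<And>A. A \<in> k_sets n k \<Longrightarrow> card {\<pi>. \<pi> permutes {1..n} \<and> \<pi> ` A \<in> F} = b"
  shows "\<exists>c. is_fold_colouring (complement_graph (K_ge n k t)) b (fact n) c"
proof -
  let ?P = "{\<pi>. \<pi> permutes {1..n}}"
  have "card ?P = fact n" by (rule card_permutations) auto
  moreover have "finite ?P" by (simp add: finite_permutations)
  ultimately obtain e where e: "bij_betw e ?P {..<fact n :: nat}"
    using ex_bij_betw_finite_nat[of ?P] by (auto simp: atLeast0LessThan)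
  define S where "S A = {\<pi>. \<pi> permutes {1..n} \<and> \<pi> ` A \<in> F}" for A
  have SP: "S A \<subseteq> ?P" for A by (auto simp: S_def)
  have inj: "inj_on e ?P" using e by (simp add: bij_betw_def)
  have "e ` S A \<subseteq> {..<fact n}" for A using e SP by (auto simp: bij_betw_def)
  moreover have "card (e ` S A) = b" if "A \<in> k_sets n k" for A
    using b[OF that] card_image[OF inj_on_subset[OF inj SP]] unfolding S_def by simp
  moreover have "e ` S A \<inter> e ` S B = {}" if lt: "card (A \<inter> B) < t" for A B
  proof (rule ccontr)
    assume "e ` S A \<inter> e ` S B \<noteq> {}"
    then have "S A \<inter> S B \<noteq> {}" using inj_on_image_Int[OF inj SP SP] by (metis image_empty)
    then obtain \<pi> where \<pi>: "\<pi> permutes {1..n}" "\<pi> ` A \<in> F" "\<pi> ` B \<in> F" unfolding S_def by blast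
    have "card (\<pi> ` A \<inter> \<pi> ` B) = card (A \<inter> B)"
      using permutes_inj[OF \<pi>(1)] by (simp add: image_Int[symmetric] card_image inj_on_subset)
    then show False using F \<pi> lt unfolding intersecting_def by (metis not_le)
  qed
  ultimately show ?thesis
    unfolding is_fold_colouring_complement_K_ge by (intro exI[of _ "\<lambda>A. e ` S A"]) blast
qed

theorem theorem3p9:
  fixes n k t :: nat
  assumes "1 \<le> t" and "t \<le> k" and "k \<le> n"
  shows "fractional_clique_cover_number (K_ge n k t) =
           real (n choose k) / real (frankl_max n k t)"
proof -
  let ?H = "complement_graph (K_ge n k t)" and ?f = "frankl_max n k t"
  have f_pos: "0 < ?f" using frankl_max_pos assms by blast
  have c_pos: "0 < n choose k" using assms by simp
  obtain r where r: "?f = card (frankl_family n k t r)" using frankl_max_attained[of t n k] assms by auto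
  let ?F = "frankl_family n k t r"
  define b where "b = card {\<pi>. \<pi> permutes {1..n} \<and> \<pi> ` {1..k} \<in> ?F}"
  have "{1..k} \<in> k_sets n k" using assms by (simp add: k_sets_def)
  \<comment> \<open>This yields (n choose k) b = n! f, so n! colours give exactly the ratio required
    by the lower bound.\<close>
  note b_eq = card_permutations_into[OF frankl_family_subset this, of t r, folded b_def r]
  have "card {\<pi>. \<pi> permutes {1..n} \<and> \<pi> ` A \<in> ?F} = b" if "A \<in> k_sets n k" for A
    using card_permutations_into[OF frankl_family_subset that, of t r, folded r] b_eq c_pos
    by (metis mult_left_cancel less_numeral_extra(3))
  then obtain c where c: "is_fold_colouring ?H b (fact n) c"
    using permutation_fold_colouring[OF intersecting_frankl_family] by blast
  show ?thesis
    unfolding fractional_clique_cover_number_def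
  proof (rule fractional_chromatic_number_eqI[OF _ _ _ _ c])
    have "verts ?H = k_sets n k" by (simp add: complement_graph_def K_ge_def k_sets_def)
    then show "finite (verts ?H)" by simp
    show "\<not> adj ?H v v" for v by (simp add: complement_graph_def)
    show "real (n choose k) / real ?f * real b' \<le> real m"
      if "is_fold_colouring ?H b' m c'" for b' m c'
    proof -
      have "real (b' * (n choose k)) \<le> real (m * ?f)"
        using fold_colouring_lower_bound[OF assms that] of_nat_le_iff by blast
      then show ?thesis using f_pos by (simp add: divide_le_eq mult.commute)
    qed
    have "0 < (n choose k) * b" unfolding b_eq using f_pos by simp
    then show "1 \<le> b" by simp
    have "real (n choose k) * real b = real (fact n) * real ?f"
      using b_eq by (metis of_nat_mult)
    then show "real (fact n) = real (n choose k) / real ?f * real b" using f_pos by (simp add: field_simps)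
  qed
qed

end
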